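(* Let $q$ be a power of $2$, and let $f(X)=X^4\bigl(1+aX^{q-1}+bX^{3(q-1)}\bigr)\in\mathbb{F}_{q^2}[X]$, where $a\in\mathbb{F}_q^*$ and $b\in\mathbb{F}_{q^2}^*$. Then $f$ is a permutation polynomial of $\mathbb{F}_{q^2}$ if and only if $a=b$ and the polynomial $X^3+X+a^{-1}$ has no root in $\mathbb{F}_q$.
   Context: $\mathbb{F}_q$ denotes the finite field with $q$ elements and $\mathbb{F}_q^*$ its multiplicative group of nonzero elements. A polynomial $f\in\mathbb{F}_{q^2}[X]$ is a permutation polynomial of $\mathbb{F}_{q^2}$ if the map $x\mapsto f(x)$ is a bijection of $\mathbb{F}_{q^2}$ onto itself. *)

theory Defs
  imports "HOL-Computational_Algebra.Polynomial" "HOL-Library.Cardinality"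
begin

(* The fields of order q^2 and q are rendered as a finite field type 'a with
   CARD('a) = q^2 and a subfield K of it with card K = q. *)

definition is_subfield :: "'a::field set \<Rightarrow> bool" where
  "is_subfield K \<longleftrightarrow>
     0 \<in> K \<and> 1 \<in> K \<and>
     (\<forall>x\<in>K. \<forall>y\<in>K. x + y \<in> K \<and> x * y \<in> K) \<and>
     (\<forall>x\<in>K. - x \<in> K \<and> inverse x \<in> K)"

definition permutation_poly :: "'a::{field,finite} poly \<Rightarrow> bool" where
  "permutation_poly f \<longleftrightarrow> bij (\<lambda>x. poly f x)"

end

theory Submission
  imports Defs
begin

text \<open>
  Let \<open>\<mu>\<close> be the group of \<open>(q + 1)\<close>-th roots of unity and \<open>h = 1 + a X + b X\<^sup>3\<close>. Since
  \<open>f(y)\<^bsup>q-1\<^esup> = g(y\<^bsup>q-1\<^esup>)\<close> with \<open>g = X\<^sup>4 h\<^bsup>q-1\<^esup>\<close>, the polynomial \<open>f\<close> permutes iff \<open>h\<close> has no zero on \<open>\<mu>\<close>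
  and \<open>g\<close> is injective on \<open>\<mu>\<close>; there \<open>x\<^sup>q = 1/x\<close>, so that \<open>g = X (X\<^sup>3 + a X\<^sup>2 + b\<^sup>q) / h\<close>.

  If \<open>a = b\<close>, then for \<open>x \<noteq> y\<close> in \<open>\<mu>\<close>, \<open>u = x + y\<close> and \<open>v = x y\<close>, the equation \<open>g(x) = g(y)\<close> reads
  \<open>u\<^sup>3 + a u\<^sup>2 (v + 1) + a (v + 1)\<^sup>3 = 0\<close>, i.e. \<open>(v + 1)/u\<close>, which lies in \<open>K\<close>, is a root of
  \<open>X\<^sup>3 + X + 1/a\<close>. Conversely such a root produces a collision because \<open>K\<close> is not the union of two
  proper additive subgroups.

  That \<open>a = b\<close> is necessary follows from the vanishing of the power sums of \<open>g\<close> over \<open>\<mu>\<close> with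
  exponents 1, 3 and 5. As \<open>X h = b X\<^sup>4 + a X\<^sup>2 + X\<close> is additive, \<open>X\<close> raised to \<open>2\<^sup>k\<close> is congruent to
  some \<open>\<lambda> X + \<kappa> X\<^sup>2\<close> modulo \<open>X h\<close>. Raising this to a power of two describes \<open>X\<^sup>q\<close> modulo powers of
  \<open>h\<close>, and comparing with \<open>x\<^sup>q = 1/x\<close> evaluates sums of \<open>P/h\<^sup>s\<close> over \<open>\<mu>\<close> in closed form. Exponent 1
  leaves \<open>\<lambda> = 0\<close> or a family parametrised by \<open>a/b\<close>; exponents 3 and 5 exclude \<open>a \<noteq> b\<close> in both cases.
\<close>

section \<open>Quadratic extensions of finite fields of even order\<close>

lemma subfield_power_card:
  fixes K :: "'a::{field,finite} set"
  assumes K: "is_subfield K" and x: "x \<in> K" "x \<noteq> 0"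
  shows "x ^ (card K - 1) = 1"
proof -
  \<comment> \<open>Multiplication by \<open>x\<close> permutes the nonzero elements of
    \<open>K\<close>, so comparing their products leaves a power of \<open>x\<close> equal to
    1.\<close>
  have inj: "inj_on ((*) x) (K - {0})"
    using x by (auto intro!: inj_onI)
  have "(*) x ` (K - {0}) \<subseteq> K - {0}"
    using K x by (auto simp: is_subfield_def)
  then have "(*) x ` (K - {0}) = K - {0}"
    using inj by (simp add: endo_inj_surj)
  then have "(\<Prod>y\<in>K - {0}. y) = (\<Prod>y\<in>(*) x ` (K - {0}). y)" by simp
  also have "\<dots> = x ^ card (K - {0}) * (\<Prod>y\<in>K - {0}. y)"
    using inj by (simp add: prod.reindex prod.distrib)
  finally show ?thesis
    using K by (simp add: is_subfield_def)
qed

lemma subfield_UNIV: "is_subfield UNIV"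
  by (simp add: is_subfield_def)

text \<open>Translation by 1 permutes the field, so adding 1 to every element does not change the
  sum of all elements.\<close>

lemma of_nat_card_eq_0: "of_nat CARD('a) = (0 :: 'a::{field,finite})"
proof -
  have "(\<Sum>x\<in>UNIV. x) = (\<Sum>x\<in>UNIV. x + (1::'a))"
    by (rule sum.reindex_bij_witness[of _ "\<lambda>x. x + 1" "\<lambda>x. x - 1"]) auto
  then show ?thesis by (simp add: sum.distrib)
qed

locale char2_quadratic_extension =
  fixes q n :: nat and K :: "'a::{field,finite} set"
  assumes n_pos: "n \<ge> 1" and q_eq: "q = 2 ^ n"
    and card_UNIV_eq: "CARD('a) = q\<^sup>2"
    and subfield_K: "is_subfield K" and card_K: "card K = q"
begin

lemma two_eq_0: "(2::'a) = 0"
proof -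
  have "(of_nat (q\<^sup>2) :: 'a) = 0"
    using of_nat_card_eq_0[where ?'a = 'a] card_UNIV_eq by simp
  then have "((2::'a) ^ n)\<^sup>2 = 0" by (simp add: q_eq)
  then show ?thesis by simp
qed

text \<open>
  The premise is existential because \<open>algebra\<close> can find such an \<open>r\<close>, whereas it cannot exploit \<open>2 = 0\<close>.
\<close>

lemma eq_mod_2I: "\<exists>r. x - y = 2 * r \<Longrightarrow> x = (y::'a)"
  using two_eq_0 by auto

lemma add_self [simp]: "x + x = (0::'a)"
  using two_eq_0 by (metis mult_2 mult_zero_left)

lemma minus_eq [simp]: "- x = (x::'a)"
  by (simp add: minus_unique)

lemma diff_eq [simp]: "x - y = (x + y :: 'a)"
  by (metis minus_eq uminus_add_conv_diff add.commute)

lemma add_eq_0_iff_eq: "x + y = 0 \<longleftrightarrow> x = (y::'a)"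
  by (metis diff_eq eq_iff_diff_eq_0)

lemma add_self_left [simp]: "x + (x + y) = (y::'a)"
  by (simp flip: add.assoc)

lemma add_eq_swap: "x = y + z \<Longrightarrow> x + y = (z::'a)"
  by (simp add: add.commute[of y z] add.assoc)

lemma power2_add: "(x + y)\<^sup>2 = x\<^sup>2 + (y\<^sup>2 :: 'a)"
  by (simp add: power2_sum two_eq_0)

lemma power_2pow_add: "(x + y) ^ (2 ^ k) = x ^ (2 ^ k) + (y ^ (2 ^ k) :: 'a)"
  by (induction k) (simp_all add: power_mult power2_add mult.commute[of 2])

lemma power_2pow_inj: "x ^ (2 ^ k) = y ^ (2 ^ k) \<longleftrightarrow> x = (y::'a)"
  by (metis add_eq_0_iff_eq power_2pow_add power_eq_0_iff zero_less_numeral zero_less_power)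

lemma q_ge_2: "q \<ge> 2"
  using n_pos self_le_power[of 2 n] by (simp add: q_eq)

lemma power_q_add: "(x + y) ^ q = x ^ q + (y ^ q :: 'a)"
  by (simp add: q_eq power_2pow_add)

lemma power_q_q: "(x ^ q) ^ q = (x::'a)"
proof (cases "x = 0")
  case False
  have "x ^ (q\<^sup>2 - 1) = 1"
    using subfield_power_card[OF subfield_UNIV, of x] False card_UNIV_eq by simp
  then have "x ^ (q\<^sup>2 - 1) * x = x" by simp
  moreover have "q\<^sup>2 > 0" using q_ge_2 by simp
  ultimately show ?thesis
    by (metis power_minus_mult power_mult power2_eq_square)
qed (use q_ge_2 in auto)

lemma roots_of_unity_bound:
  assumes "j > 0"
  shows "card {x::'a. x ^ j = 1} \<le> j"
proof -
  let ?p = "monom 1 j - 1 :: 'a poly"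
  have *: "coeff ?p j = 1" using assms by (simp add: coeff_1)
  then have "?p \<noteq> 0" by (metis coeff_0 zero_neq_one)
  moreover have "degree ?p \<le> j"
    by (intro degree_diff_le) (auto simp: degree_monom_le)
  moreover have "{x. x ^ j = 1} = {x. poly ?p x = 0}"
    by (simp add: poly_monom add_eq_0_iff_eq)
  ultimately show ?thesis
    using card_poly_roots_bound[of ?p] by simp
qed

text \<open>The q - 1 units of \<open>K\<close> exhaust the roots of X^(q-1) = 1, of which there are
  at most q - 1; hence \<open>K\<close> is the fixed field of conjugation.\<close>

lemma mem_K_iff: "x \<in> K \<longleftrightarrow> x ^ q = x"
proof -
  have "K - {0} \<subseteq> {x. x ^ (q - 1) = 1}"
    using subfield_power_card[OF subfield_K] card_K by auto
  moreover have "card (K - {0}) = q - 1"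
    using subfield_K card_K by (simp add: is_subfield_def)
  ultimately have "K - {0} = {x. x ^ (q - 1) = 1}"
    using roots_of_unity_bound[of "q - 1"] q_ge_2 by (intro card_seteq) auto
  then have "x \<in> K \<longleftrightarrow> x ^ (q - 1) = 1" if "x \<noteq> 0"
    using that by auto
  moreover have "x ^ q = x ^ (q - 1) * x"
    using q_ge_2 by (simp flip: power_Suc2)
  moreover have "0 \<in> K" using subfield_K by (simp add: is_subfield_def)
  ultimately show ?thesis
    using q_ge_2 by (cases "x = 0") auto
qed

section \<open>The group of (q + 1)-th roots of unity and its power sums\<close>

definition mu :: "'a set" where "mu = {x. x ^ (q + 1) = 1}"

lemma mu_nonzero: "x \<in> mu \<Longrightarrow> x \<noteq> 0"
  by (auto simp: mu_def)

lemma mu_power_q: "x \<in> mu \<Longrightarrow> x ^ q = inverse x"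
  by (simp add: mu_def inverse_unique)

lemma mem_mu_iff: "x \<in> mu \<longleftrightarrow> x * x ^ q = 1"
  by (simp add: mu_def)

lemma mu_mult: "x \<in> mu \<Longrightarrow> y \<in> mu \<Longrightarrow> x * y \<in> mu"
  by (simp only: mu_def mem_Collect_eq power_mult_distrib mult_1)

lemma mu_divide: "x \<in> mu \<Longrightarrow> y \<in> mu \<Longrightarrow> x / y \<in> mu"
  by (simp only: mu_def mem_Collect_eq power_divide div_by_1)

lemma power_q_minus_1_mem_mu:
  assumes "x \<noteq> 0"
  shows "x ^ (q - 1) \<in> mu"
proof -
  have "x * x ^ (q - 1) = x ^ q"
    using q_ge_2 by (simp flip: power_Suc)
  then have eq: "x ^ (q - 1) = x ^ q / x" using assms by (simp add: field_simps)
  show ?thesis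
    unfolding mem_mu_iff eq using assms by (simp add: power_divide power_q_q)
qed

text \<open>Fibres of the (q - 1)-th power map on the units have at most q - 1 elements, so its
  image has at least q + 1. The image lies in \<open>mu\<close>, which has at most q + 1
  elements.\<close>

lemma card_mu: "card mu = q + 1"
  and image_mu: "(\<lambda>x. x ^ (q - 1)) ` (UNIV - {0}) = mu"
proof -
  let ?f = "\<lambda>x::'a. x ^ (q - 1)"
  have sub: "?f ` (UNIV - {0}) \<subseteq> mu"
    using power_q_minus_1_mem_mu by auto
  have le: "card mu \<le> q + 1"
    unfolding mu_def by (rule roots_of_unity_bound) simp
  have fib: "card {x \<in> UNIV - {0}. ?f x = y} \<le> q - 1"
    if "y \<in> ?f ` (UNIV - {0})" for y
  proof -
    from that obtain z where "y = z ^ (q - 1)" "z \<in> UNIV - {0}" by (rule imageE)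
    then have z: "z \<noteq> 0" "y = z ^ (q - 1)" by simp_all
    have "card {x \<in> UNIV - {0}. ?f x = y} \<le> card {x::'a. x ^ (q - 1) = 1}"
    proof (rule card_inj_on_le[where f = "\<lambda>x. x / z"])
      show "inj_on (\<lambda>x. x / z) {x \<in> UNIV - {0}. ?f x = y}"
        using z(1) by (intro inj_onI) simp
      have "(x / z) ^ (q - 1) = 1" if "?f x = y" for x
        using that z by (simp only: power_divide) simp
      then show "(\<lambda>x. x / z) ` {x \<in> UNIV - {0}. ?f x = y} \<subseteq> {x. x ^ (q - 1) = 1}"
        by blast
    qed simp
    also have "\<dots> \<le> q - 1"
      using q_ge_2 by (intro roots_of_unity_bound) simp
    finally show ?thesis .
  qed
  have "(q - 1) * (q + 1) = card (UNIV - {0::'a})"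
    using card_UNIV_eq q_ge_2 by (simp add: power2_eq_square algebra_simps)
  also have "\<dots> = (\<Sum>y\<in>?f ` (UNIV - {0}). card {x \<in> UNIV - {0}. ?f x = y})"
    using sum.image_gen[of "UNIV - {0::'a}" "\<lambda>_. 1::nat" ?f] by simp
  also have "\<dots> \<le> (\<Sum>y\<in>?f ` (UNIV - {0}). q - 1)"
    by (rule sum_mono) (rule fib)
  finally have "(q - 1) * (q + 1) \<le> (q - 1) * card (?f ` (UNIV - {0}))"
    by (simp add: mult.commute)
  then have ge: "q + 1 \<le> card (?f ` (UNIV - {0}))"
    using q_ge_2 by (simp only: mult_le_cancel1)
  have "card (?f ` (UNIV - {0})) \<le> card mu"
    using sub by (simp add: card_mono)
  then show "card mu = q + 1" using ge le by simp
  then show "?f ` (UNIV - {0}) = mu"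
    using sub ge by (intro card_seteq) auto
qed

lemma mu_eq_power:
  assumes "x \<in> mu"
  shows "\<exists>y. y \<noteq> 0 \<and> y ^ (q - 1) = x"
proof -
  have "x \<in> (\<lambda>x. x ^ (q - 1)) ` (UNIV - {0})" using assms by (simp only: image_mu)
  then obtain y where "x = y ^ (q - 1)" "y \<in> UNIV - {0}" by (rule imageE)
  then show ?thesis by (intro exI[of _ y]) simp
qed

text \<open>As j < q + 1, some z in \<open>mu\<close> has z^j different from 1; substituting z x for
  x multiplies the sum by z^j.\<close>

lemma sum_mu_power:
  assumes "0 < j" "j \<le> q"
  shows "(\<Sum>x\<in>mu. x ^ j) = 0"
proof -
  have "\<not> mu \<subseteq> {x. x ^ j = 1}"
    using card_mono[of "{x::'a. x ^ j = 1}" mu] roots_of_unity_bound[of j] card_mu assms by auto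
  then obtain z where z: "z \<in> mu" "z ^ j \<noteq> 1" by auto
  have "(\<Sum>x\<in>mu. x ^ j) = (\<Sum>x\<in>mu. (z * x) ^ j)"
    using z mu_nonzero
    by (intro sum.reindex_bij_witness[of _ "\<lambda>x. z * x" "\<lambda>x. x / z"])
       (auto simp: mu_mult mu_divide)
  also have "\<dots> = z ^ j * (\<Sum>x\<in>mu. x ^ j)"
    by (simp add: power_mult_distrib sum_distrib_left)
  finally show ?thesis using z by simp
qed

text \<open>Positive exponents up to q contribute nothing, and the constant term is counted q + 1
  times, which is once in characteristic 2.\<close>

lemma sum_mu_poly:
  assumes "degree p \<le> q"
  shows "(\<Sum>x\<in>mu. poly p x) = coeff p 0"
proof -
  have "(\<Sum>x\<in>mu. poly p x) = (\<Sum>x\<in>mu. \<Sum>i\<le>q. coeff p i * x ^ i)"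
    using assms
    by (intro sum.cong refl) (auto simp: poly_altdef intro!: sum.mono_neutral_left le_degree)
  also have "\<dots> = (\<Sum>i\<le>q. coeff p i * (\<Sum>x\<in>mu. x ^ i))"
    by (subst sum.swap) (simp add: sum_distrib_left)
  also have "\<dots> = (\<Sum>i\<in>{0}. coeff p i * (\<Sum>x\<in>mu. x ^ i))"
    using sum_mu_power by (intro sum.mono_neutral_right) auto
  also have "\<dots> = coeff p 0 * of_nat (q + 1)" by (simp add: card_mu)
  also have "(of_nat (q + 1) :: 'a) = 1"
    using n_pos by (simp add: q_eq two_eq_0)
  finally show ?thesis by simp
qed

lemma K_add: "x \<in> K \<Longrightarrow> y \<in> K \<Longrightarrow> x + y \<in> K"
  and K_mult: "x \<in> K \<Longrightarrow> y \<in> K \<Longrightarrow> x * y \<in> K"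
  and K_divide: "x \<in> K \<Longrightarrow> y \<in> K \<Longrightarrow> x / y \<in> K"
  and K_power: "x \<in> K \<Longrightarrow> x ^ k \<in> K"
  and one_mem_K: "1 \<in> K"
  by (simp_all add: mem_K_iff power_q_add power_mult_distrib power_divide)
    (metis mult.commute power_mult)

section \<open>Elements of trace one and the Artin-Schreier map\<close>

lemma exists_conjugate_plus_one: "\<exists>w::'a. w ^ q = w + 1"
proof -
  have "card K < CARD('a)"
    using card_K card_UNIV_eq q_ge_2 by (simp add: power2_eq_square)
  then obtain w where w: "w \<notin> K"
    by (metis UNIV_eq_I less_irrefl)
  \<comment> \<open>The trace of \<open>w\<close> lies in \<open>K\<close> and is nonzero, so
    division by it normalises the trace to 1.\<close>
  define t where "t = w ^ q + w"
  have t: "t \<noteq> 0" using w by (simp add: t_def mem_K_iff add_eq_0_iff_eq)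
  have "t ^ q = t" by (simp add: t_def power_q_add power_q_q add.commute)
  then have "(w / t) ^ q = (w + t) / t"
    by (simp add: power_divide t_def add.commute)
  then show ?thesis using t by (auto simp: add_divide_distrib)
qed

abbreviation artin_schreier :: "'a \<Rightarrow> 'a" where
  "artin_schreier w \<equiv> w + w\<^sup>2"

lemma artin_schreier_add:
  "artin_schreier (v + w) = artin_schreier v + artin_schreier w"
  by (simp add: power2_add algebra_simps)

lemma artin_schreier_eq_iff:
  "artin_schreier v = artin_schreier w \<longleftrightarrow> v = w \<or> v = w + 1"
proof -
  have "artin_schreier v + artin_schreier w = (v + w) * (v + (w + 1))"
    by (rule eq_mod_2I) algebra
  then show ?thesis
    by (metis add_eq_0_iff_eq mult_eq_0_iff)
qed

lemma conjugate_plus_one_not_artin_schreier: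
  assumes "w ^ q = w + 1"
  shows "artin_schreier w \<notin> artin_schreier ` K"
proof
  assume "artin_schreier w \<in> artin_schreier ` K"
  then obtain k where "k \<in> K" "w = k \<or> w = k + 1"
    using artin_schreier_eq_iff by auto
  then have "w \<in> K" using one_mem_K K_add by auto
  then show False using assms by (simp add: mem_K_iff)
qed

text \<open>The map is additive with fibres of at most two elements, so its image on
  \<open>K\<close> has index at most 2. The value at an element of trace one represents the other
  coset.\<close>

lemma artin_schreier_cover:
  assumes "c \<in> K" "c \<notin> artin_schreier ` K"
  shows "\<exists>w. w ^ q = w + 1 \<and> artin_schreier w = c"
proof -
  let ?H = "artin_schreier ` K"
  obtain w :: 'a where w: "w ^ q = w + 1" using exists_conjugate_plus_one by blast
  let ?H' = "(+) (artin_schreier w) ` ?H"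
  have "artin_schreier w \<in> K"
    using w by (simp add: mem_K_iff power_q_add power_commutes flip: power_mult)
      (simp add: mult.commute[of 2] power_mult power2_add ac_simps)
  moreover have "?H \<subseteq> K" using K_add K_power by blast
  ultimately have sub: "?H \<union> ?H' \<subseteq> K" using K_add by blast
  have "?H \<inter> ?H' = {}"
  proof (rule equals0I)
    fix x assume "x \<in> ?H \<inter> ?H'"
    then obtain k l where "k \<in> K" "l \<in> K" "artin_schreier k = artin_schreier w + artin_schreier l"
      by blast
    then have "artin_schreier w = artin_schreier (k + l)" "k + l \<in> K"
      by (metis add_self_left add.commute artin_schreier_add) (use \<open>k \<in> K\<close> \<open>l \<in> K\<close> K_add in auto)
    then show False using conjugate_plus_one_not_artin_schreier[OF w] by blast
  qed
  then have "card (?H \<union> ?H') = card ?H + card ?H'" by (simp add: card_Un_disjoint)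
  also have "card ?H' = card ?H" by (rule card_image) simp
  finally have card_Un: "card (?H \<union> ?H') = 2 * card ?H" by simp
  have "card K = (\<Sum>y\<in>?H. card {x \<in> K. artin_schreier x = y})"
    using sum.image_gen[of K "\<lambda>_. 1::nat" artin_schreier] by simp
  also have "\<dots> \<le> (\<Sum>y\<in>?H. 2)"
  proof (rule sum_mono)
    fix y assume "y \<in> ?H"
    then obtain k where "y = artin_schreier k" by auto
    then have "{x \<in> K. artin_schreier x = y} \<subseteq> {k, k + 1}"
      using artin_schreier_eq_iff by auto
    then have "card {x \<in> K. artin_schreier x = y} \<le> card {k, k + 1}"
      by (intro card_mono) auto
    also have "\<dots> \<le> 2" by (simp add: card_insert_if)
    finally show "card {x \<in> K. artin_schreier x = y} \<le> 2" .
  qed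
  finally have "?H \<union> ?H' = K" using sub card_Un by (intro card_seteq) auto
  then obtain k where k: "k \<in> K" "c = artin_schreier w + artin_schreier k"
    using assms by blast
  have "(w + k) ^ q = w + k + 1" using w k by (simp add: power_q_add mem_K_iff ac_simps)
  then show ?thesis using k artin_schreier_add by metis
qed

text \<open>Elements of trace one with a prescribed ratio of Artin-Schreier values; they will
  parametrise two elements of \<open>mu\<close>.\<close>

lemma artin_schreier_pair:
  assumes "y \<in> K" "y \<noteq> 0"
  shows "\<exists>v w. v ^ q = v + 1 \<and> w ^ q = w + 1 \<and> artin_schreier w = y * artin_schreier v"
proof -
  let ?H = "artin_schreier ` K"
  obtain w :: 'a where w: "w ^ q = w + 1" using exists_conjugate_plus_one by blast
  define d where "d = artin_schreier w"
  have d: "d \<notin> ?H" using conjugate_plus_one_not_artin_schreier[OF w] by (simp add: d_def)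
  have "d ^ q = w ^ q + (w ^ q)\<^sup>2"
    by (simp add: d_def power_q_add mult.commute flip: power_mult)
  then have dK: "d \<in> K"
    using w by (simp add: mem_K_iff power2_add d_def ac_simps)
  have H_add: "u + v \<in> ?H" if "u \<in> ?H" "v \<in> ?H" for u v
    using that K_add artin_schreier_add by (metis (no_types, lifting) imageE imageI)
  \<comment> \<open>\<open>K\<close> is not the union of \<open>?H\<close> and its multiple by 1/y.
    For \<open>d\<close> outside \<open>?H\<close>, failure puts y d and d / y into
    \<open>?H\<close>, and then d + d / y lies in neither subgroup.\<close>
  have "\<exists>c\<in>K. c \<notin> ?H \<and> y * c \<notin> ?H"
  proof (rule ccontr)
    assume "\<not> ?thesis"
    then have *: "c \<in> ?H \<or> y * c \<in> ?H" if "c \<in> K" for c using that by blast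
    have e: "d / y \<in> K" "y * (d / y) = d"
      using K_divide dK assms by auto
    have "y * d \<in> ?H" using *[OF dK] d by blast
    have "d / y \<in> ?H" using *[OF e(1)] e(2) d by auto
    have "d + d / y \<in> ?H \<or> y * (d + d / y) \<in> ?H" using * K_add dK e by blast
    then show False
    proof
      assume "d + d / y \<in> ?H"
      then have "(d + d / y) + d / y \<in> ?H" using H_add \<open>d / y \<in> ?H\<close> by blast
      then show False using d by (simp add: add.assoc)
    next
      assume "y * (d + d / y) \<in> ?H"
      then have "y * d + y * (d + d / y) \<in> ?H" using H_add \<open>y * d \<in> ?H\<close> by blast
      then show False using d e(2) by (simp only: distrib_left add_self_left)
    qed
  qed
  then obtain c where "c \<in> K" "c \<notin> ?H" "y * c \<notin> ?H" by blast
  then show ?thesis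
    using artin_schreier_cover[of c] artin_schreier_cover[of "y * c"] K_mult assms by metis
qed

end

section \<open>Reduction to a rational function on the roots of unity\<close>

locale trinomial = char2_quadratic_extension q n K
  for q n and K :: "'a::{field,finite} set" +
  fixes a b :: 'a
  assumes a_mem: "a \<in> K" and a_nonzero: "a \<noteq> 0" and b_nonzero: "b \<noteq> 0"
begin

abbreviation bc :: 'a where "bc \<equiv> b ^ q"

definition h :: "'a \<Rightarrow> 'a" where "h x = 1 + a * x + b * x ^ 3"

text \<open>The reversed conjugate of \<open>h\<close>: on \<open>mu\<close>, where conjugation is
  inversion, it equals x^3 times the conjugate of \<open>h x\<close>.\<close>

definition R :: "'a \<Rightarrow> 'a" where "R x = x ^ 3 + a * x\<^sup>2 + bc"

definition g :: "'a \<Rightarrow> 'a" where "g x = x * R x / h x"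

lemma a_power_q: "a ^ q = a"
  using a_mem by (simp add: mem_K_iff)

lemma h_power_q:
  assumes "x \<in> mu"
  shows "x ^ 3 * h x ^ q = R x"
proof -
  have "(x ^ 3) ^ q = (x ^ q) ^ 3" by (simp add: mult.commute flip: power_mult)
  then have "h x ^ q = 1 + a * inverse x + bc * inverse x ^ 3"
    using assms by (simp add: h_def power_q_add power_mult_distrib a_power_q mu_power_q)
  then have "x ^ 3 * h x ^ q = x ^ 3 + a * (x ^ 3 * inverse x) + bc * (x ^ 3 * inverse x ^ 3)"
    by (simp add: algebra_simps)
  also have "\<dots> = R x"
    using mu_nonzero[OF assms]
    by (simp add: R_def flip: power_mult_distrib) (simp add: power2_eq_square power3_eq_cube mult.assoc)
  finally show ?thesis .
qed

lemma g_eq: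
  assumes "x \<in> mu" "h x \<noteq> 0"
  shows "g x = x ^ 4 * h x ^ (q - 1)"
proof -
  have "h x ^ q = h x ^ (q - 1) * h x"
    using q_ge_2 by (simp flip: power_Suc2)
  then have "x ^ 4 * h x ^ (q - 1) * h x = x * (x ^ 3 * h x ^ q)"
    by (simp add: power_Suc eval_nat_numeral)
  then show ?thesis
    using assms by (simp add: g_def h_power_q field_simps)
qed

lemma g_mem_mu: "x \<in> mu \<Longrightarrow> h x \<noteq> 0 \<Longrightarrow> g x \<in> mu"
  unfolding g_eq by (intro mu_mult power_q_minus_1_mem_mu)
    (auto simp: eval_nat_numeral intro!: mu_mult)

text \<open>The (q - 1)-th power map carries \<open>f\<close> on the units to \<open>g\<close> on
  \<open>mu\<close>. A zero of \<open>h\<close> on \<open>mu\<close> is exactly a second zero class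
  of \<open>f\<close> besides 0.\<close>

lemma permutation_poly_iff:
  assumes "f = monom 1 4 * (1 + monom a (q - 1) + monom b (3 * (q - 1)))"
  shows "permutation_poly f \<longleftrightarrow> (\<forall>x\<in>mu. h x \<noteq> 0) \<and> inj_on g mu"
proof -
  define F where "F = poly f"
  have F: "F y = y ^ 4 * h (y ^ (q - 1))" for y
    by (simp add: F_def assms poly_monom h_def power_mult mult.commute[of 3])
  have F0: "F 0 = 0" by (simp add: F)
  have F_power: "F y ^ (q - 1) = g (y ^ (q - 1))"
    if "y \<noteq> 0" "h (y ^ (q - 1)) \<noteq> 0" for y
  proof -
    have "F y ^ (q - 1) = (y ^ (q - 1)) ^ 4 * h (y ^ (q - 1)) ^ (q - 1)"
      by (simp add: F power_mult_distrib mult.commute flip: power_mult)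
    then show ?thesis using that power_q_minus_1_mem_mu by (simp add: g_eq)
  qed
  have perm: "permutation_poly f \<longleftrightarrow> inj F"
    unfolding permutation_poly_def F_def bij_def using finite_UNIV_inj_surj[of "poly f"] by auto
  show ?thesis
  proof (intro iffI conjI ballI)
    assume "permutation_poly f"
    then have inj: "inj F" and surj: "surj F"
      using perm finite_UNIV_inj_surj[of F] by auto
    show nz: "h x \<noteq> 0" if x: "x \<in> mu" for x
    proof
      assume "h x = 0"
      obtain y where y: "y \<noteq> 0" "y ^ (q - 1) = x" using mu_eq_power[OF x] by blast
      then have "F y = F 0" using \<open>h x = 0\<close> by (simp add: F)
      then show False using y inj by (simp add: inj_eq)
    qed
    \<comment> \<open>Surjectivity of \<open>f\<close> descends to \<open>g\<close>, and on a finite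
      set it gives injectivity.\<close>
    have "mu \<subseteq> g ` mu"
    proof
      fix z assume "z \<in> mu"
      then obtain w where w: "w \<noteq> 0" "w ^ (q - 1) = z" using mu_eq_power[OF \<open>z \<in> mu\<close>] by blast
      obtain y where y: "F y = w" using surj by (metis surjD)
      then have "y \<noteq> 0" using w F0 by auto
      then have "z = g (y ^ (q - 1))"
        using F_power[of y] nz power_q_minus_1_mem_mu[of y] w y by auto
      then show "z \<in> g ` mu" using \<open>y \<noteq> 0\<close> power_q_minus_1_mem_mu by blast
    qed
    then show "inj_on g mu"
      using card_image_le[of mu g] card_mono[of "g ` mu" mu] by (intro eq_card_imp_inj_on) auto
  next
    assume *: "(\<forall>x\<in>mu. h x \<noteq> 0) \<and> inj_on g mu"
    have nz: "F y \<noteq> 0" if "y \<noteq> 0" for y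
      using that * power_q_minus_1_mem_mu by (simp add: F)
    have "inj F"
    proof (rule injI)
      fix x y assume eq: "F x = F y"
      show "x = y"
      proof (cases "x = 0 \<or> y = 0")
        case True
        then show ?thesis using eq nz F0 by metis
      next
        case False
        then have mem: "x ^ (q - 1) \<in> mu" "y ^ (q - 1) \<in> mu"
          using power_q_minus_1_mem_mu by auto
        then have g: "g (x ^ (q - 1)) = g (y ^ (q - 1))"
          using F_power[of x] F_power[of y] * eq False by simp
        have "inj_on g mu" using * by (rule conjunct2)
        from inj_onD[OF this g mem] have same: "x ^ (q - 1) = y ^ (q - 1)" .
        \<comment> \<open>On a single fibre \<open>f\<close> is a nonzero constant times X^4, which
          is injective in characteristic 2.\<close>
        then have "x ^ 2 ^ 2 = y ^ 2 ^ 2"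
          using eq * mem by (simp add: F)
        then show ?thesis by (simp only: power_2pow_inj)
      qed
    qed
    then show "permutation_poly f" using perm by simp
  qed
qed

lemma sum_g_power:
  assumes nz: "\<forall>x\<in>mu. h x \<noteq> 0" and inj: "inj_on g mu" and "0 < s" "s \<le> q"
  shows "(\<Sum>x\<in>mu. g x ^ s) = 0"
proof -
  have "g ` mu = mu" using nz inj g_mem_mu by (intro endo_inj_surj) auto
  then have "(\<Sum>x\<in>mu. g x ^ s) = (\<Sum>x\<in>mu. x ^ s)"
    using sum.reindex[OF inj, of "\<lambda>x. x ^ s"] by simp
  then show ?thesis using sum_mu_power assms by simp
qed

section \<open>The case \<open>a = b\<close>: collisions of \<open>g\<close> and roots of the
  cubic\<close>

lemma collision_iff:
  assumes "a = b" "h x \<noteq> 0" "h y \<noteq> 0" "x \<noteq> y"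
  shows "g x = g y \<longleftrightarrow>
    (x + y) ^ 3 + a * (x + y)\<^sup>2 * (x * y + 1) + a * (x * y + 1) ^ 3 = 0"
proof -
  have bc: "bc = a" using assms a_power_q by simp
  have "g x = g y \<longleftrightarrow> x * R x * h y + y * R y * h x = 0"
    using assms(2,3) by (simp add: g_def field_simps add_eq_0_iff_eq)
  \<comment> \<open>The cross-multiplied difference is divisible by x + y, and the cofactor is
    symmetric, hence a polynomial in x + y and x y.\<close>
  also have "x * R x * h y + y * R y * h x =
     (x + y) * ((x + y) ^ 3 + a * (x + y)\<^sup>2 * (x * y + 1) + a * (x * y + 1) ^ 3)"
    unfolding R_def h_def bc unfolding assms(1)[symmetric] by (rule eq_mod_2I) algebra
  finally show ?thesis using assms(4) by (simp add: add_eq_0_iff_eq)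
qed

text \<open>A zero of \<open>h\<close> on \<open>mu\<close> is also a zero of the reversed conjugate
  \<open>R\<close>. Eliminating between the two leaves x = 1, where \<open>h\<close> has the value
  1.\<close>

lemma h_nonzero_of_eq:
  assumes "a = b" "x \<in> mu"
  shows "h x \<noteq> 0"
proof
  assume h: "h x = 0"
  have bc: "bc = a" using assms a_power_q by simp
  have R: "R x = 0" using h h_power_q[OF assms(2)] q_ge_2 by (simp add: zero_power)
  have "x * (1 + x)\<^sup>2 = x * (h x + a * R x) + (R x + a * h x)"
    unfolding R_def h_def bc unfolding assms(1)[symmetric] by (rule eq_mod_2I) algebra
  then have "x = 1" using h R mu_nonzero[OF assms(2)] by (simp add: add_eq_0_iff_eq)
  then show False using h unfolding h_def unfolding assms(1)[symmetric] by (simp add: add.assoc)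
qed

lemma inj_on_g_iff:
  assumes "a = b"
  shows "inj_on g mu \<longleftrightarrow> (\<forall>y\<in>K. y ^ 3 + y + inverse a \<noteq> 0)"
proof (intro iffI ballI notI)
  fix y assume inj: "inj_on g mu" and y: "y \<in> K" "y ^ 3 + y + inverse a = 0"
  have y0: "y \<noteq> 0" using y a_nonzero by auto
  obtain v w where v: "v ^ q = v + 1" and w: "w ^ q = w + 1"
    and vw: "artin_schreier w = y * artin_schreier v"
    using artin_schreier_pair[OF y(1) y0] by blast
  have nz: "u \<noteq> 0" "u + 1 \<noteq> 0" if "u ^ q = u + 1" for u :: 'a
    using that q_ge_2 by (metis add_self add.left_neutral one_neq_zero power_eq_0_iff
        zero_power power_one neq0_conv not_numeral_le_zero add_eq_0_iff_eq)+
  have mem: "(u + 1) / u \<in> mu" if "u ^ q = u + 1" for u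
    using that nz[OF that] by (simp add: mem_mu_iff power_divide power_q_add add.assoc)
  \<comment> \<open>The colliding pair is z s and z / s, with product z^2. Since z + 1/z is the
    inverse of the Artin-Schreier value of v, and likewise for s and w, the quotient (z^2 + 1) / (z
    s + z / s) equals y.\<close>
  define z where "z = (v + 1) / v"
  define s where "s = (w + 1) / w"
  have zs: "z \<in> mu" "s \<in> mu" using mem v w by (auto simp: z_def s_def)
  have z0: "z \<noteq> 0" "s \<noteq> 0" using zs mu_nonzero by auto
  have z: "(z\<^sup>2 + 1) * artin_schreier v = z"
    using nz[OF v] unfolding z_def
    by (simp add: field_simps power2_eq_square)
  have s: "(s\<^sup>2 + 1) * artin_schreier w = s"
    using nz[OF w] unfolding s_def
    by (simp add: field_simps power2_eq_square)
  have v0: "artin_schreier v \<noteq> 0" using z z0 by auto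
  have "(z * s + z / s) * y * artin_schreier v = (z / s) * ((s\<^sup>2 + 1) * artin_schreier w)"
    unfolding vw using z0 by (simp add: divide_simps power2_eq_square) (simp add: algebra_simps)
  also have "\<dots> = (z\<^sup>2 + 1) * artin_schreier v" using s z z0 by simp
  finally have uv: "(z * s + z / s) * y = z\<^sup>2 + 1" using v0 by simp
  let ?u = "z * s + z / s"
  have u0: "?u \<noteq> 0" using z uv z0 by auto
  have prod: "z * s * (z / s) = z\<^sup>2" using z0 by (simp add: power2_eq_square)
  \<comment> \<open>Substituting v + 1 = y u into the collision polynomial factors out a u^3 and
    leaves the cubic in y.\<close>
  have "?u ^ 3 + a * ?u\<^sup>2 * (z\<^sup>2 + 1) + a * (z\<^sup>2 + 1) ^ 3 =
      a * ?u ^ 3 * (y ^ 3 + y + inverse a)"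
    unfolding uv[symmetric] using a_nonzero by (simp add: field_simps eval_nat_numeral)
  then have "g (z * s) = g (z / s)"
    using collision_iff[OF assms, of "z * s" "z / s"] h_nonzero_of_eq[OF assms] zs y u0 prod
    by (simp add: mu_mult mu_divide add_eq_0_iff_eq)
  then show False
    using inj zs u0 by (auto simp: inj_on_eq_iff mu_mult mu_divide add_eq_0_iff_eq)
next
  assume noroot: "\<forall>y\<in>K. y ^ 3 + y + inverse a \<noteq> 0"
  show "inj_on g mu"
  proof (rule inj_onI, rule ccontr)
    fix x y assume xy: "x \<in> mu" "y \<in> mu" "g x = g y" "x \<noteq> y"
    define u v where "u = x + y" and "v = x * y"
    have uv: "u ^ 3 + a * u\<^sup>2 * (v + 1) + a * (v + 1) ^ 3 = 0"
      using collision_iff[OF assms] h_nonzero_of_eq[OF assms] xy by (simp add: u_def v_def)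
    have u0: "u \<noteq> 0" using xy by (simp add: u_def add_eq_0_iff_eq)
    have nz: "x \<noteq> 0" "y \<noteq> 0" using xy mu_nonzero by auto
    have "v + 1 \<noteq> 0" using uv u0 by auto
    have conj: "u ^ q = u / v" "v ^ q = inverse v"
      using xy nz by (simp_all add: u_def v_def power_q_add power_mult_distrib mu_power_q field_simps)
    have v0: "v \<noteq> 0" using nz by (simp add: v_def)
    define k where "k = (v + 1) / u"
    \<comment> \<open>Conjugation inverts v and sends u to u / v, so it fixes this quotient.\<close>
    have "k ^ q = (inverse v + 1) / (u / v)"
      by (simp add: k_def power_divide power_q_add conj)
    also have "\<dots> = k" using u0 v0 by (simp add: k_def field_simps)
    finally have "k \<in> K" by (simp add: mem_K_iff)
    have "v + 1 = k * u" using u0 by (simp add: k_def)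
    then have "a * u ^ 3 * (k ^ 3 + k + inverse a) = 0"
      using uv a_nonzero by (simp add: field_simps eval_nat_numeral)
    then show False using noroot \<open>k \<in> K\<close> u0 a_nonzero by simp
  qed
qed

end

section \<open>Power sums over the roots of unity\<close>

context trinomial
begin

section \<open>Iterated Frobenius modulo the additive polynomial X h\<close>

definition alpha :: 'a where "alpha = a / b"
definition beta :: 'a where "beta = inverse b"

text \<open>Coordinates of X^(2^k) in the basis X, X^2 modulo X h. The recursion squares and
  replaces X^4 by alpha X^2 + beta X, which is how \<open>alpha\<close> and \<open>beta\<close>
  arise.\<close>

primrec frob :: "nat \<Rightarrow> 'a \<times> 'a" where
  "frob 0 = (1, 0)"
| "frob (Suc k) = (beta * (snd (frob k))\<^sup>2, (fst (frob k))\<^sup>2 + alpha * (snd (frob k))\<^sup>2)"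

abbreviation "lam k \<equiv> fst (frob k)"
abbreviation "mi k \<equiv> snd (frob k)"

text \<open>The quotient belonging to that remainder; the coefficient list in the recursion is X h
  itself.\<close>

primrec W :: "nat \<Rightarrow> 'a poly" where
  "W 0 = 0"
| "W (Suc k) = [:beta * (mi k)\<^sup>2:] + [:0, 1, a, 0, b:] * (W k)\<^sup>2"

lemma alpha_nonzero: "alpha \<noteq> 0" and beta_nonzero: "beta \<noteq> 0"
  and a_eq: "a = alpha * b" and b_beta: "b * beta = 1"
  using a_nonzero b_nonzero by (simp_all add: alpha_def beta_def)

lemma power_eq_frob: "x ^ (2 ^ k) = lam k * x + mi k * x\<^sup>2 + x * h x * poly (W k) x"
proof (induction k)
  case (Suc k)
  have *: "beta * (x * h x) = beta * x + alpha * x\<^sup>2 + x ^ 4"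
    using b_nonzero by (simp add: h_def alpha_def beta_def field_simps eval_nat_numeral)
  have "x ^ (2 ^ Suc k) = (lam k * x + mi k * x\<^sup>2 + x * h x * poly (W k) x)\<^sup>2"
    by (simp only: Suc.IH[symmetric] power_Suc2 power_mult)
  also have "\<dots> = (lam k)\<^sup>2 * x\<^sup>2 + (mi k)\<^sup>2 * x ^ 4 + (x * h x)\<^sup>2 * (poly (W k) x)\<^sup>2"
    by (rule eq_mod_2I) algebra
  also have "x ^ 4 = beta * (x * h x) + beta * x + alpha * x\<^sup>2"
    unfolding * by (rule eq_mod_2I) algebra
  finally show ?case
    by (simp add: h_def algebra_simps power2_eq_square eval_nat_numeral)
qed simp

lemma W_0: "k < 2 \<Longrightarrow> W k = 0"
  by (auto simp: less_2_cases_iff)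

text \<open>Dividing X^(2^k) by the quartic X h lowers the degree by 4; from k = 2 on this bound is
  meaningful.\<close>

lemma degree_W: "k \<ge> 2 \<Longrightarrow> degree (W k) + 4 \<le> 2 ^ k"
proof (induction k rule: dec_induct)
  case base
  then show ?case by (simp add: numeral_2_eq_2)
next
  case (step k)
  have "degree ([:0, 1, a, 0, b:] * (W k)\<^sup>2) \<le> 4 + 2 * degree (W k)"
    using degree_mult_le[of "[:0, 1, a, 0, b:]" "(W k)\<^sup>2"] degree_power_le[of "W k" 2]
    by (simp split: if_splits)
  then have "degree (W (Suc k)) \<le> 4 + 2 * degree (W k)"
    by (simp only: W.simps) (intro degree_add_le, simp_all)
  then show ?case using step by simp
qed

text \<open>On \<open>mu\<close> the sparse factor in front of A is a multiple of h^e, because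
  conjugation is inversion. A representation of P in this form therefore turns P / h^s into a
  polynomial of degree at most q, whose sum is its constant term.\<close>

lemma sum_certificate:
  fixes P A B :: "'a poly"
  assumes nz: "\<forall>x\<in>mu. h x \<noteq> 0" and r: "r \<le> n" and e: "e = 2 ^ r" and s: "s \<le> e"
    and P: "\<And>x. poly P x =
      (1 + lam (n - r) ^ e * x ^ (e + 1) + mi (n - r) ^ e * x ^ (2 * e + 1)) * poly A x
        + h x ^ s * poly B x"
    and A: "degree A < 3 * s" and B: "degree B \<le> q"
  shows "(\<Sum>x\<in>mu. poly P x / h x ^ s) = coeff B 0"
proof -
  define V where "V = monom 1 (e + 1) * [:1, a, 0, b:] ^ (e - s) * W (n - r) ^ e * A"
  have h_poly: "poly [:1, a, 0, b:] x = h x" for x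
    by (simp add: h_def algebra_simps eval_nat_numeral)
  have "poly P x / h x ^ s = poly (V + B) x" if x: "x \<in> mu" for x
  proof -
    have "x ^ q = (x ^ (2 ^ (n - r))) ^ e"
      using r by (simp add: q_eq e flip: power_mult power_add)
    also have "\<dots> = lam (n - r) ^ e * x ^ e + mi (n - r) ^ e * x ^ (2 * e)
        + x ^ e * h x ^ e * poly (W (n - r)) x ^ e"
      unfolding power_eq_frob by (simp add: e power_2pow_add power_mult_distrib flip: power_mult)
    \<comment> \<open>the first summand of \<open>P\<close> thus becomes \<open>h\<^sup>s V\<close>, where \<open>V\<close> has no constant term\<close>
    finally have "1 = (lam (n - r) ^ e * x ^ (e + 1) + mi (n - r) ^ e * x ^ (2 * e + 1))
        + x ^ (e + 1) * h x ^ e * poly (W (n - r)) x ^ e"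
      using x by (simp add: mem_mu_iff algebra_simps)
    from add_eq_swap[OF this] have "1 + lam (n - r) ^ e * x ^ (e + 1) + mi (n - r) ^ e * x ^ (2 * e + 1)
        = x ^ (e + 1) * h x ^ e * poly (W (n - r)) x ^ e"
      by (simp only: add.assoc)
    also have "h x ^ e = h x ^ s * h x ^ (e - s)" using s by (simp flip: power_add)
    finally have "poly P x = h x ^ s * poly (V + B) x"
      unfolding P by (simp add: V_def poly_monom h_poly algebra_simps del: poly_pCons)
    then show ?thesis using nz x by simp
  qed
  then have "(\<Sum>x\<in>mu. poly P x / h x ^ s) = (\<Sum>x\<in>mu. poly (V + B) x)" by simp
  also have "\<dots> = coeff (V + B) 0"
  proof (rule sum_mu_poly, rule degree_add_le[OF _ B])
    show "degree V \<le> q"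
    proof (cases "n - r \<ge> 2")
      case True
      \<comment> \<open>The bounds add up to exactly q: (e + 1) + 3(e - s) + (q - 4e) + (3s - 1),
        which is why A must have degree below 3s.\<close>
      have "degree V \<le> (e + 1) + (e - s) * 3 + degree (W (n - r)) * e + degree A"
        unfolding V_def
        by (intro order_trans[OF degree_mult_le] add_mono order_trans[OF degree_power_le]
            degree_monom_le) (auto simp: mult.commute)
      moreover have "(degree (W (n - r)) + 4) * e \<le> 2 ^ (n - r) * e"
        using degree_W[OF True] by simp
      moreover have "2 ^ (n - r) * e = q" using r by (simp add: q_eq e flip: power_add)
      ultimately show ?thesis using A s by (simp add: algebra_simps)
    next
      case False
      \<comment> \<open>Here W is 0 and so is V.\<close>
      then show ?thesis by (simp add: V_def W_0 e zero_power)
    qed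
  qed
  also have "\<dots> = coeff B 0" by (simp add: V_def coeff_mult_0 mult.assoc)
  finally show ?thesis .
qed

text \<open>A norm: a nonzero root \<rho> of X h satisfies \<rho>^(2^k - 1) = lam k + mi k \<rho>.
  The left-hand side is the product of these values over the three roots, whose own product is
  \<open>beta\<close>.\<close>

lemma frob_nu: "lam k ^ 3 + alpha * lam k * (mi k)\<^sup>2 + beta * mi k ^ 3 = beta ^ (2 ^ k - 1)"
proof (induction k)
  case (Suc k)
  have "lam (Suc k) ^ 3 + alpha * lam (Suc k) * (mi (Suc k))\<^sup>2 + beta * mi (Suc k) ^ 3
      = beta * (lam k ^ 3 + alpha * lam k * (mi k)\<^sup>2 + beta * mi k ^ 3)\<^sup>2"
    unfolding frob.simps fst_conv snd_conv by (rule eq_mod_2I) algebra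
  also have "\<dots> = beta ^ Suc ((2 ^ k - 1) * 2)" unfolding Suc.IH by (simp add: power_mult)
  also have "Suc ((2 ^ k - 1) * 2) = 2 ^ Suc k - 1"
    using one_le_power[of "2::nat" k] unfolding power_Suc by arith
  finally show ?case .
qed simp

text \<open>The two coordinates of (X h)^(2^k), which vanish modulo X h. The induction step is the
  squaring recursion of \<open>frob\<close> applied to this pair.\<close>

lemma frob_conj:
  "b ^ (2 ^ k) * beta * ((lam k)\<^sup>2 + alpha * (mi k)\<^sup>2)\<^sup>2
      + a ^ (2 ^ k) * beta * (mi k)\<^sup>2 + lam k = 0 \<and>
   b ^ (2 ^ k) * (alpha * ((lam k)\<^sup>2 + alpha * (mi k)\<^sup>2)\<^sup>2 + beta\<^sup>2 * mi k ^ 4)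
      + a ^ (2 ^ k) * ((lam k)\<^sup>2 + alpha * (mi k)\<^sup>2) + mi k = 0"
  (is "?Q1 k = 0 \<and> ?Q2 k = 0")
proof (induction k)
  case 0
  show ?case using a_eq by (simp add: b_beta mult.commute)
next
  case (Suc k)
  have sq: "x ^ 2 ^ Suc k = (x ^ 2 ^ k)\<^sup>2" for x :: 'a
    by (simp only: power_Suc mult.commute[of 2] power_mult)
  have id1: "d\<^sup>2 * beta * ((beta * m\<^sup>2)\<^sup>2 + alpha * (l\<^sup>2 + alpha * m\<^sup>2)\<^sup>2)\<^sup>2
      + c\<^sup>2 * beta * (l\<^sup>2 + alpha * m\<^sup>2)\<^sup>2 + beta * m\<^sup>2
      = beta * (d * (alpha * (l\<^sup>2 + alpha * m\<^sup>2)\<^sup>2 + beta\<^sup>2 * m ^ 4)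
          + c * (l\<^sup>2 + alpha * m\<^sup>2) + m)\<^sup>2"
    for c d l m by (rule eq_mod_2I) algebra
  have id2: "d\<^sup>2 * (alpha * ((beta * m\<^sup>2)\<^sup>2 + alpha * (l\<^sup>2 + alpha * m\<^sup>2)\<^sup>2)\<^sup>2
        + beta\<^sup>2 * (l\<^sup>2 + alpha * m\<^sup>2) ^ 4)
      + c\<^sup>2 * ((beta * m\<^sup>2)\<^sup>2 + alpha * (l\<^sup>2 + alpha * m\<^sup>2)\<^sup>2) + (l\<^sup>2 + alpha * m\<^sup>2)
      = alpha * (d * (alpha * (l\<^sup>2 + alpha * m\<^sup>2)\<^sup>2 + beta\<^sup>2 * m ^ 4)
          + c * (l\<^sup>2 + alpha * m\<^sup>2) + m)\<^sup>2
        + (d * beta * (l\<^sup>2 + alpha * m\<^sup>2)\<^sup>2 + c * beta * m\<^sup>2 + l)\<^sup>2"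
    for c d l m by (rule eq_mod_2I) algebra
  have "?Q1 (Suc k) = beta * (?Q2 k)\<^sup>2"
    unfolding sq frob.simps fst_conv snd_conv by (rule id1)
  moreover have "?Q2 (Suc k) = alpha * (?Q2 k)\<^sup>2 + (?Q1 k)\<^sup>2"
    unfolding sq frob.simps fst_conv snd_conv by (rule id2)
  ultimately show ?case using Suc.IH by (simp only:) simp
qed

end

section \<open>The first power sum of \<open>g\<close>\<close>

context char2_quadratic_extension
begin

text \<open>The certificate for x R(x) / h(x) in the variable X = b x. Here l is
  \<open>lam n\<close>, \<zeta> is \<open>beta * mi n\<close>, \<eta> is the square of
  \<open>mi n\<close>, e is \<open>beta\<^sup>2\<close> and d is the conjugate of b divided by
  b.\<close>

lemma first_moment_certificate:
  fixes \<alpha> l \<zeta> \<eta> e d X :: 'a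
  defines "\<theta> \<equiv> l\<^sup>2 + \<alpha> * \<eta>"
  defines "A0 \<equiv> \<alpha> + d * (\<alpha> * \<theta> + l)"
    and "A1 \<equiv> \<alpha>\<^sup>2 + d * (e * \<eta> + \<alpha>\<^sup>2 * \<theta> + \<alpha> * l + \<zeta> + 1)"
    and "A2 \<equiv> d * (e * \<alpha> * \<eta> + e * \<theta> + \<alpha> * \<zeta>)"
  assumes l: "l \<noteq> 0"
    and z: "\<zeta>\<^sup>2 = e * \<eta>"
    and r1: "d * \<theta>\<^sup>2 = l + \<alpha> * \<eta>"
    and r2: "d * e * \<eta>\<^sup>2 = \<alpha> * l + \<alpha> * l\<^sup>2 + \<zeta>"
    and r3: "d * (l * \<theta> + \<zeta> * \<eta>) = 1"
  shows "d * X + \<alpha> * e * X ^ 3 + e\<^sup>2 * X ^ 4 =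
    (1 + e * l * X\<^sup>2 + e * \<zeta> * X ^ 3) * (A0 + A1 * X + A2 * X\<^sup>2)
      + (1 + \<alpha> * X + e * X ^ 3) * (A0 + (d + A1 + \<alpha> * A0) * X + \<zeta> * A2 * X\<^sup>2)"
proof -
  define z' where "z' = \<zeta>\<^sup>2 + e * \<eta>"
  define p1 where "p1 = d * \<theta>\<^sup>2 + (l + \<alpha> * \<eta>)"
  define p2 where "p2 = d * e * \<eta>\<^sup>2 + (\<alpha> * l + \<alpha> * l\<^sup>2 + \<zeta>)"
  define p3 where "p3 = d * (l * \<theta> + \<zeta> * \<eta>) + 1"
  \<comment> \<open>A further relation that becomes available only after cancelling
    \<open>l\<close>.\<close>
  define y where "y = d * \<theta> * \<zeta> + \<alpha> * (1 + l)"
  have zeros: "z' = 0" "p1 = 0" "p2 = 0" "p3 = 0"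
    using z r1 r2 r3 by (simp_all add: z'_def p1_def p2_def p3_def)
  have "l * y = \<zeta> * p3 + p2 + d * \<eta> * z'"
    unfolding y_def p3_def p2_def z'_def by (rule eq_mod_2I) algebra
  then have y: "y = 0" using zeros l by simp
  \<comment> \<open>The coefficients of X^0, X and X^5 agree by the choice of the second factor;
    these are the remaining discrepancies, each a combination of the relations.\<close>
  define c2 c3 c4 where "c2 = A2 + e * l * A0 + \<zeta> * A2 + \<alpha> * (d + A1 + \<alpha> * A0)"
    and "c3 = \<alpha> * e + e * l * A1 + e * \<zeta> * A0 + \<alpha> * \<zeta> * A2 + e * A0"
    and "c4 = e\<^sup>2 + e * l * A2 + e * \<zeta> * A1 + e * (d + A1 + \<alpha> * A0)"
  have "c2 = e * l * \<alpha> * p3 + \<alpha> * d * z' + d * e * l * (\<zeta> * p1 + \<theta> * y)"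
    unfolding c2_def A0_def A1_def A2_def p3_def z'_def p1_def y_def \<theta>_def
    by (rule eq_mod_2I) algebra
  then have c2: "c2 = 0" using zeros y by simp
  have "c3 = \<alpha>\<^sup>2 * d * z' + e * (\<alpha>\<^sup>2 * p3 + \<alpha> * y + \<alpha> * \<zeta> * p3 + d * \<alpha> * \<eta> * z'
      + d * (\<theta> * \<zeta> * y + d * \<theta>\<^sup>2 * z' + e * \<eta> * p1))"
    unfolding c3_def A0_def A1_def A2_def p3_def z'_def p1_def y_def \<theta>_def
    by (rule eq_mod_2I) algebra
  then have c3: "c3 = 0" using zeros y by simp
  have "c4 = e * (e * p3 + d * z' + \<alpha> * (\<alpha> * \<zeta> * p3 + d * \<alpha> * \<eta> * z'
      + d * (\<theta> * \<zeta> * y + d * \<theta>\<^sup>2 * z' + e * \<eta> * p1)))"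
    unfolding c4_def A0_def A1_def A2_def p3_def z'_def p1_def y_def \<theta>_def
    by (rule eq_mod_2I) algebra
  then have c4: "c4 = 0" using zeros y by simp
  have "d * X + \<alpha> * e * X ^ 3 + e\<^sup>2 * X ^ 4 =
    (1 + e * l * X\<^sup>2 + e * \<zeta> * X ^ 3) * (A0 + A1 * X + A2 * X\<^sup>2)
      + (1 + \<alpha> * X + e * X ^ 3) * (A0 + (d + A1 + \<alpha> * A0) * X + \<zeta> * A2 * X\<^sup>2)
      + c2 * X\<^sup>2 + c3 * X ^ 3 + c4 * X ^ 4"
    unfolding c2_def c3_def c4_def by (rule eq_mod_2I) algebra
  then show ?thesis using c2 c3 c4 by simp
qed

end

context trinomial
begin

text \<open>This is \<open>mi (Suc n)\<close>, the X^2-coordinate of X^(2q).\<close>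

abbreviation "theta \<equiv> (lam n)\<^sup>2 + alpha * (mi n)\<^sup>2"
abbreviation "dd \<equiv> bc * beta"

text \<open>This and the next two relations specialise \<open>frob_conj\<close> and
  \<open>frob_nu\<close> to k = n, where the 2^k-th power is conjugation and fixes
  \<open>a\<close>.\<close>

lemma rel_theta: "dd * theta\<^sup>2 = lam n + alpha * (mi n)\<^sup>2"
proof -
  have "dd * theta\<^sup>2 + (a * beta * (mi n)\<^sup>2 + lam n) = 0"
    using frob_conj[of n] by (simp add: a_power_q add.assoc flip: q_eq)
  moreover have "a * beta = alpha" by (simp add: alpha_def beta_def divide_inverse)
  ultimately show ?thesis by (simp add: add_eq_0_iff_eq add.commute)
qed

lemma rel_nu: "dd * (lam n * theta + beta * mi n * (mi n)\<^sup>2) = 1"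
proof -
  have "lam n * theta + beta * mi n * (mi n)\<^sup>2 = beta ^ (q - 1)"
    using frob_nu[of n] by (simp add: q_eq algebra_simps eval_nat_numeral)
  moreover have "beta * beta ^ (q - 1) = beta ^ q"
    using q_ge_2 by (simp flip: power_Suc)
  ultimately show ?thesis
    by (simp add: mult.assoc) (simp add: b_beta flip: power_mult_distrib)
qed

lemma rel_mi: "dd * beta\<^sup>2 * ((mi n)\<^sup>2)\<^sup>2 = alpha * lam n + alpha * (lam n)\<^sup>2 + beta * mi n"
proof -
  let ?Q = "\<lambda>c. c * (alpha * theta\<^sup>2 + beta\<^sup>2 * mi n ^ 4) + a * theta + mi n"
  have id: "c * beta * beta\<^sup>2 * ((mi n)\<^sup>2)\<^sup>2 + (alpha * lam n + alpha * (lam n)\<^sup>2 + beta * mi n)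
      = beta * ?Q c + alpha * (c * beta * theta\<^sup>2 + (lam n + alpha * (mi n)\<^sup>2)) + (a * beta + alpha) * theta"
    for c by (rule eq_mod_2I) algebra
  have "?Q bc = 0" using frob_conj[of n] by (simp add: a_power_q flip: q_eq)
  moreover have "a * beta = alpha" by (simp add: alpha_def beta_def divide_inverse)
  ultimately have "dd * beta\<^sup>2 * ((mi n)\<^sup>2)\<^sup>2 + (alpha * lam n + alpha * (lam n)\<^sup>2 + beta * mi n) = 0"
    unfolding id rel_theta by simp
  then show ?thesis by (simp only: add_eq_0_iff_eq)
qed

lemma alpha_conj: "alpha ^ q * dd = alpha"
  using b_nonzero by (simp add: alpha_def beta_def power_divide a_power_q field_simps)

lemma dd_nonzero: "dd \<noteq> 0"
  using b_nonzero beta_nonzero by simp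

lemma first_moment:
  assumes nz: "\<forall>x\<in>mu. h x \<noteq> 0" and inj: "inj_on g mu" and l: "lam n \<noteq> 0"
  shows "alpha ^ q = alpha * theta + lam n"
proof -
  define A0 A1 A2 where "A0 = alpha + dd * (alpha * theta + lam n)"
    and "A1 = alpha\<^sup>2 + dd * (beta\<^sup>2 * (mi n)\<^sup>2 + alpha\<^sup>2 * theta + alpha * lam n + beta * mi n + 1)"
    and "A2 = dd * (beta\<^sup>2 * alpha * (mi n)\<^sup>2 + beta\<^sup>2 * theta + alpha * (beta * mi n))"
  define A where "A = [:A0, A1 * b, A2 * b\<^sup>2:]"
  define B where "B = [:A0, (dd + A1 + alpha * A0) * b, beta * mi n * A2 * b\<^sup>2:]"
  define P where "P = [:0, bc, 0, a, 1:]"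
  have P: "poly P x = x * R x" for x
    by (simp add: P_def R_def algebra_simps eval_nat_numeral)
  have "(\<Sum>x\<in>mu. poly P x / h x ^ 1) = coeff B 0"
  proof (rule sum_certificate[where r = 0 and e = 1 and A = A])
    fix x
    define X where "X = b * x"
    have x: "x = beta * X" using b_beta by (simp add: X_def mult.commute flip: mult.assoc)
    have "beta * X * ((beta * X) ^ 3 + alpha * b * (beta * X)\<^sup>2 + c)
        = c * beta * X + alpha * beta\<^sup>2 * X ^ 3 + (beta\<^sup>2)\<^sup>2 * X ^ 4" for c
      using b_beta by algebra
    then have "x * R x = dd * X + alpha * beta\<^sup>2 * X ^ 3 + (beta\<^sup>2)\<^sup>2 * X ^ 4"
      unfolding R_def x a_eq[symmetric] .
    moreover have "poly A x = A0 + A1 * X + A2 * X\<^sup>2" "poly B x =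
        A0 + (dd + A1 + alpha * A0) * X + beta * mi n * A2 * X\<^sup>2"
      unfolding A_def B_def X_def by (simp_all add: distrib_left power2_eq_square ac_simps)
    moreover have "1 + alpha * b * (beta * X) + b * (beta * X) ^ 3
        = 1 + alpha * X + beta\<^sup>2 * X ^ 3"
      using b_beta by algebra
    then have "h x = 1 + alpha * X + beta\<^sup>2 * X ^ 3"
      unfolding h_def x a_eq[symmetric] .
    moreover have "1 + lam (n - 0) ^ 1 * x ^ (1 + 1) + mi (n - 0) ^ 1 * x ^ (2 * 1 + 1)
       = 1 + beta\<^sup>2 * lam n * X\<^sup>2 + beta\<^sup>2 * (beta * mi n) * X ^ 3"
      unfolding x by (simp add: power_mult_distrib power2_eq_square power3_eq_cube ac_simps)
    ultimately show "poly P x = (1 + lam (n - 0) ^ 1 * x ^ (1 + 1) + mi (n - 0) ^ 1 * x ^ (2 * 1 + 1))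
        * poly A x + h x ^ 1 * poly B x"
      using first_moment_certificate[of "lam n" "beta * mi n" "beta\<^sup>2" "(mi n)\<^sup>2" dd alpha X,
          OF l _ rel_theta rel_mi rel_nu]
      unfolding P A0_def A1_def A2_def by (simp add: power_mult_distrib)
  qed (use nz q_ge_2 in \<open>auto simp: A_def B_def\<close>)
  also have "(\<Sum>x\<in>mu. poly P x / h x ^ 1) = (\<Sum>x\<in>mu. g x ^ 1)"
    by (simp add: P g_def)
  also have "\<dots> = 0" using q_ge_2 by (intro sum_g_power nz inj) auto
  \<comment> \<open>The vanishing sum is \<open>A0\<close>; writing alpha as
    \<open>alpha ^ q * dd\<close> makes \<open>dd\<close> a common factor.\<close>
  finally have "dd * (alpha ^ q + (alpha * theta + lam n)) = 0"
    using alpha_conj by (simp add: B_def A0_def distrib_left mult.commute)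
  then show ?thesis using dd_nonzero by (simp only: mult_eq_0_iff add_eq_0_iff_eq) auto
qed

text \<open>Elimination of \<open>theta\<close> and \<open>dd\<close> from the first moment and the
  three relations. All remaining data become functions of alpha and its conjugate.\<close>

lemma frob_of_first_moment:
  assumes nz: "\<forall>x\<in>mu. h x \<noteq> 0" and inj: "inj_on g mu" and l: "lam n \<noteq> 0"
  defines "\<gamma> \<equiv> alpha ^ q"
  shows "mi n = b"
    and "lam n * (1 + alpha * \<gamma>) = \<gamma> * (1 + alpha)"
    and "alpha * b\<^sup>2 * (1 + alpha * \<gamma>)\<^sup>2 = \<gamma> * (1 + alpha * \<gamma> + alpha * \<gamma> * (alpha + \<gamma>))"
proof -
  let ?l = "lam n" and ?m = "mi n"
  define \<theta> where "\<theta> = theta"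
  have \<gamma>: "\<gamma> = alpha * \<theta> + ?l"
    using first_moment[OF nz inj l] by (simp add: \<gamma>_def \<theta>_def)
  have \<gamma>d: "\<gamma> * dd = alpha" using alpha_conj by (simp add: \<gamma>_def)
  have \<theta>: "alpha * ?m\<^sup>2 = \<theta> + ?l\<^sup>2" by (simp add: \<theta>_def add.assoc add.commute)
  \<comment> \<open>Multiplying \<open>rel_theta\<close> by \<gamma> removes \<open>dd\<close>,
    since their product is alpha.\<close>
  have "alpha * \<theta>\<^sup>2 = \<gamma> * (dd * \<theta>\<^sup>2)" using \<gamma>d by (simp flip: mult.assoc)
  also have "\<dots> = (alpha * \<theta> + ?l) * (?l + (\<theta> + ?l\<^sup>2))"
    unfolding \<theta>[symmetric] \<gamma>[symmetric] unfolding \<theta>_def rel_theta ..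
  finally have e1: "alpha * \<theta>\<^sup>2 + (alpha * \<theta> + ?l) * (?l + (\<theta> + ?l\<^sup>2)) = 0" by simp
  have "?l * (alpha * \<theta> * (1 + ?l) + (\<theta> + ?l + ?l\<^sup>2))
      = alpha * \<theta>\<^sup>2 + (alpha * \<theta> + ?l) * (?l + (\<theta> + ?l\<^sup>2))"
    by (rule eq_mod_2I) algebra
  then have t1: "alpha * \<theta> * (1 + ?l) = \<theta> + ?l + ?l\<^sup>2"
    using e1 l by (simp add: add_eq_0_iff_eq)
  have "\<gamma> = alpha * (?l * \<theta> + beta * ?m * ?m\<^sup>2)"
    using rel_nu \<gamma>d by (metis \<theta>_def mult.assoc mult.right_neutral)
  also have "\<dots> = alpha * ?l * \<theta> + alpha * ?m\<^sup>2 * (beta * ?m)"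
    by (simp add: distrib_left ac_simps)
  finally have "\<gamma> = alpha * ?l * \<theta> + alpha * ?m\<^sup>2 * (beta * ?m)" .
  from add_eq_swap[OF this, symmetric]
  have "alpha * ?m\<^sup>2 * (beta * ?m) = \<gamma> + alpha * ?l * \<theta>" .
  also have "\<dots> = alpha * \<theta> * (1 + ?l) + ?l" unfolding \<gamma> by (simp add: algebra_simps)
  also have "\<dots> = alpha * ?m\<^sup>2" unfolding t1 \<theta> by (simp add: ac_simps)
  finally have e2: "?m = 0 \<or> beta * ?m = 1" using alpha_nonzero by simp
  show m: "?m = b"
  proof (cases "?m = 0")
    case True
    \<comment> \<open>If \<open>mi n\<close> were 0, \<open>lam n\<close> and \<theta> would both be
      1, and \<open>t1\<close> would read 0 = 1.\<close>
    then have "alpha * (?l * (1 + ?l)) = 0"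
      using rel_mi by (simp add: algebra_simps power2_eq_square)
    then have l1: "?l = 1" using alpha_nonzero l by (simp add: add_eq_0_iff_eq)
    then have "\<theta> = 1" using \<theta> True by (simp add: add_eq_0_iff_eq)
    then show ?thesis using t1 l1 by (simp add: add.assoc)
  next
    case False
    then have "b * (beta * ?m) = b" using e2 by simp
    then show ?thesis using b_beta by (simp flip: mult.assoc)
  qed
  have "?l * (1 + alpha * \<gamma>) + \<gamma> * (1 + alpha)
      = alpha * (alpha * \<theta> * (1 + ?l) + (\<theta> + ?l + ?l\<^sup>2))"
    unfolding \<gamma> by (rule eq_mod_2I) algebra
  then show t3: "?l * (1 + alpha * \<gamma>) = \<gamma> * (1 + alpha)"
    using t1 by (simp add: add_eq_0_iff_eq)
  have "alpha * \<theta> * (1 + alpha * \<gamma>) = (\<gamma> + ?l) * (1 + alpha * \<gamma>)"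
    unfolding \<gamma> by (simp add: add.assoc)
  also have "\<dots> = \<gamma> * (1 + alpha * \<gamma>) + \<gamma> * (1 + alpha)" using t3 by (simp add: distrib_right)
  also have "\<dots> = alpha * (\<gamma> * (1 + \<gamma>))" by (rule eq_mod_2I) algebra
  finally have t4: "\<theta> * (1 + alpha * \<gamma>) = \<gamma> * (1 + \<gamma>)" using alpha_nonzero by simp
  have "alpha * b\<^sup>2 * (1 + alpha * \<gamma>)\<^sup>2
      = (\<theta> * (1 + alpha * \<gamma>)) * (1 + alpha * \<gamma>) + (?l * (1 + alpha * \<gamma>))\<^sup>2"
    using \<theta> m by (simp add: algebra_simps power2_eq_square)
  also have "\<dots> = \<gamma> * (1 + \<gamma>) * (1 + alpha * \<gamma>) + (\<gamma> * (1 + alpha))\<^sup>2" unfolding t3 t4 ..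
  also have "\<dots> = \<gamma> * (1 + alpha * \<gamma> + alpha * \<gamma> * (alpha + \<gamma>))"
    by (rule eq_mod_2I) algebra
  finally show "alpha * b\<^sup>2 * (1 + alpha * \<gamma>)\<^sup>2
      = \<gamma> * (1 + alpha * \<gamma> + alpha * \<gamma> * (alpha + \<gamma>))" .
qed

end

section \<open>Polynomial certificates for the third and fifth power sums\<close>

lemma degree_pCons_leI: "degree p \<le> k \<Longrightarrow> degree (pCons c p) \<le> Suc k"
  by (meson degree_pCons_le Suc_le_mono order_trans)

context char2_quadratic_extension
begin

text \<open>
  Each of the next three witnesses is found by taking for the first polynomial the remainder, modulo
  the power of the cubic, of the left-hand side times the inverse of the sparse factor; the second
  polynomial is then the quotient.
\<close>

lemma third_moment_certificate_generic:
  fixes \<alpha> \<gamma> :: 'a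
  defines "\<delta> \<equiv> 1 + \<alpha> * \<gamma>" and "G \<equiv> 1 + \<alpha> * \<gamma> + \<alpha> * \<gamma> * (\<alpha> + \<gamma>)"
  defines "C \<equiv> \<alpha> * \<gamma> * G"
  shows "\<exists>A B. degree A \<le> 8 \<and> degree B \<le> 8 \<and>
    coeff B 0 = \<alpha>^4 * \<gamma>^2 * \<delta>^5 * G^3 * (1 + \<alpha> * \<gamma> + \<alpha>^2 * \<gamma> + \<alpha>^2 * \<gamma>^3 + \<alpha>^3 * \<gamma>^3 + \<alpha>^4 * \<gamma>^2) \<and>
    (\<forall>Z. \<alpha>^2 * \<delta>^4 * G * \<gamma> * Z^3 * (\<delta> * Z^3 + C * Z^2 + \<alpha> * C * G)^3 =
      (\<alpha>^3 * C^3 * \<delta>^4 + \<alpha>^2 * C * (\<gamma> * \<delta>^2 * (1 + \<alpha>) + C * (1 + \<alpha>^2 * \<gamma>)) * Z^5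
          + (1 + \<alpha>^2 * \<gamma>) * Z^9) * poly A Z
        + (Z^3 + \<alpha> * C * Z + \<alpha> * C * \<delta>)^3 * poly B Z)"
proof (intro exI conjI allI)
  let ?A = "[:\<alpha>^4 * \<gamma>^2 * \<delta>^4 * G^3 * (1 + \<alpha> * \<gamma> + \<alpha>^2 * \<gamma> + \<alpha>^2 * \<gamma>^3 + \<alpha>^3 * \<gamma>^3 + \<alpha>^4 * \<gamma>^2),
        \<alpha>^5 * \<gamma>^3 * \<delta>^3 * G^3 * (1 + \<gamma> + \<alpha> * \<gamma> + \<alpha>^2 * \<gamma> + \<alpha>^2 * \<gamma>^2 + \<alpha>^3 * \<gamma>),
        \<alpha>^4 * \<gamma>^3 * \<delta>^2 * G^2 * (1 + \<alpha>^2 + \<alpha>^2 * \<gamma>^2 + \<alpha>^2 * \<gamma>^3 + \<alpha>^4 * \<gamma> + \<alpha>^4 * \<gamma>^2 + \<alpha>^4 * \<gamma>^4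
          + \<alpha>^6 * \<gamma>^2),
        \<alpha>^3 * \<gamma>^3 * G^2 * (1 + \<alpha> * \<gamma> + \<alpha> * \<gamma>^2 + \<alpha>^2 + \<alpha>^2 * \<gamma>^2 + \<alpha>^3 + \<alpha>^3 * \<gamma> + \<alpha>^3 * \<gamma>^2 + \<alpha>^4 * \<gamma>^2
          + \<alpha>^4 * \<gamma>^4 + \<alpha>^5 * \<gamma> + \<alpha>^5 * \<gamma>^3 + \<alpha>^6 * \<gamma>^2 + \<alpha>^6 * \<gamma>^5 + \<alpha>^7 * \<gamma>^2 + \<alpha>^8 * \<gamma>^3),
        \<alpha>^2 * \<gamma>^2 * G^2 * (1 + \<alpha> + \<alpha> * \<gamma> + \<alpha> * \<gamma>^2 + \<alpha>^2 * \<gamma> + \<alpha>^3 * \<gamma>^2 + \<alpha>^3 * \<gamma>^3 + \<alpha>^4 * \<gamma> + \<alpha>^4 * \<gamma>^2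
          + \<alpha>^4 * \<gamma>^3 + \<alpha>^4 * \<gamma>^4 + \<alpha>^5 * \<gamma>^4 + \<alpha>^5 * \<gamma>^5 + \<alpha>^6 * \<gamma>^2 + \<alpha>^6 * \<gamma>^3 + \<alpha>^7 * \<gamma>^3),
        \<alpha>^2 * \<gamma>^3 * \<delta>^2 * G * (1 + \<alpha> * \<gamma> + \<alpha>^2 * \<gamma> + \<alpha>^3),
        \<delta>^2 * G * (1 + \<alpha> * \<gamma> + \<alpha> * \<gamma>^2 + \<alpha>^2 * \<gamma> + \<alpha>^2 * \<gamma>^2 + \<alpha>^3 * \<gamma>^2 + \<alpha>^3 * \<gamma>^3 + \<alpha>^4 * \<gamma>^2),
        \<alpha> * \<gamma> * (\<gamma> + \<alpha> + \<alpha> * \<gamma>^3 + \<alpha> * \<gamma>^4 + \<alpha>^2 * \<gamma> + \<alpha>^2 * \<gamma>^3 + \<alpha>^2 * \<gamma>^4 + \<alpha>^3 * \<gamma> + \<alpha>^3 * \<gamma>^4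
          + \<alpha>^4 * \<gamma>^2 + \<alpha>^4 * \<gamma>^3 + \<alpha>^4 * \<gamma>^5 + \<alpha>^5 * \<gamma>^2 + \<alpha>^6 * \<gamma>^3),
        \<gamma> * (1 + \<alpha> + \<alpha> * \<gamma>^3 + \<alpha>^2 + \<alpha>^2 * \<gamma> + \<alpha>^2 * \<gamma>^2 + \<alpha>^3 * \<gamma>^2 + \<alpha>^3 * \<gamma>^3 + \<alpha>^3 * \<gamma>^4 + \<alpha>^4 * \<gamma>
          + \<alpha>^4 * \<gamma>^2 + \<alpha>^5 * \<gamma>^2):]"
  let ?B = "[:\<alpha>^4 * \<gamma>^2 * \<delta>^5 * G^3 * (1 + \<alpha> * \<gamma> + \<alpha>^2 * \<gamma> + \<alpha>^2 * \<gamma>^3 + \<alpha>^3 * \<gamma>^3 + \<alpha>^4 * \<gamma>^2),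
        \<alpha>^4 * \<gamma>^2 * \<delta>^5 * G^4,
        \<alpha>^4 * \<gamma>^3 * \<delta>^5 * G^2 * (1 + \<alpha> + \<alpha> * \<gamma> + \<alpha>^2),
        \<alpha>^3 * \<gamma>^2 * \<delta>^5 * G^2 * (\<gamma> + \<alpha>),
        \<alpha>^2 * \<gamma> * \<delta> * G^2 * (1 + \<gamma> + \<alpha> * \<gamma> + \<alpha> * \<gamma>^2 + \<alpha> * \<gamma>^3 + \<alpha>^2 * \<gamma> + \<alpha>^3 * \<gamma>^4 + \<alpha>^4 * \<gamma>^4),
        \<alpha>^2 * \<gamma>^2 * G * (1 + \<gamma> + \<alpha> + \<alpha> * \<gamma>^2 + \<alpha> * \<gamma>^3 + \<alpha>^2 * \<gamma> + \<alpha>^2 * \<gamma>^2 + \<alpha>^4 * \<gamma>^2 + \<alpha>^4 * \<gamma>^3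
          + \<alpha>^4 * \<gamma>^4 + \<alpha>^4 * \<gamma>^5 + \<alpha>^5 * \<gamma>^3 + \<alpha>^5 * \<gamma>^4 + \<alpha>^6 * \<gamma>^2 + \<alpha>^6 * \<gamma>^4 + \<alpha>^6 * \<gamma>^5 + \<alpha>^6 * \<gamma>^6
          + \<alpha>^7 * \<gamma>^4 + \<alpha>^7 * \<gamma>^6 + \<alpha>^8 * \<gamma>^3 + \<alpha>^8 * \<gamma>^4 + \<alpha>^9 * \<gamma>^4),
        G * (1 + \<alpha> * \<gamma> + \<alpha> * \<gamma>^2 + \<alpha>^2 * \<gamma>^2 + \<alpha>^3 * \<gamma>^2 + \<alpha>^3 * \<gamma>^3 + \<alpha>^3 * \<gamma>^4 + \<alpha>^3 * \<gamma>^5 + \<alpha>^4 * \<gamma>^2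
          + \<alpha>^4 * \<gamma>^3 + \<alpha>^5 * \<gamma>^5 + \<alpha>^6 * \<gamma>^3 + \<alpha>^7 * \<gamma>^4 + \<alpha>^7 * \<gamma>^7 + \<alpha>^8 * \<gamma>^4 + \<alpha>^9 * \<gamma>^5),
        \<alpha> * \<gamma> * (\<gamma> + \<alpha> + \<alpha> * \<gamma>^3 + \<alpha> * \<gamma>^4 + \<alpha>^2 * \<gamma> + \<alpha>^2 * \<gamma>^2 + \<alpha>^2 * \<gamma>^3 + \<alpha>^2 * \<gamma>^4 + \<alpha>^3 * \<gamma>^5
          + \<alpha>^4 * \<gamma>^3 + \<alpha>^4 * \<gamma>^4 + \<alpha>^5 * \<gamma>^5 + \<alpha>^6 * \<gamma>^4 + \<alpha>^6 * \<gamma>^6 + \<alpha>^7 * \<gamma>^3 + \<alpha>^8 * \<gamma>^4),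
        \<gamma> * (1 + \<alpha> + \<alpha> * \<gamma>^3 + \<alpha>^2 + \<alpha>^2 * \<gamma>^2 + \<alpha>^3 * \<gamma> + \<alpha>^3 * \<gamma>^2 + \<alpha>^3 * \<gamma>^3 + \<alpha>^4 * \<gamma>^3 + \<alpha>^5 * \<gamma>^2
          + \<alpha>^5 * \<gamma>^3 + \<alpha>^5 * \<gamma>^4 + \<alpha>^5 * \<gamma>^5 + \<alpha>^6 * \<gamma>^2 + \<alpha>^6 * \<gamma>^3 + \<alpha>^7 * \<gamma>^3):]"
  show "degree ?A \<le> 8" "degree ?B \<le> 8" unfolding eval_nat_numeral by (intro degree_pCons_leI, simp)+
  show "coeff ?B 0 = \<alpha>^4 * \<gamma>^2 * \<delta>^5 * G^3 * (1 + \<alpha> * \<gamma> + \<alpha>^2 * \<gamma> + \<alpha>^2 * \<gamma>^3 + \<alpha>^3 * \<gamma>^3 + \<alpha>^4 * \<gamma>^2)" by simp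
  fix Z :: 'a
  show "\<alpha>^2 * \<delta>^4 * G * \<gamma> * Z^3 * (\<delta> * Z^3 + C * Z^2 + \<alpha> * C * G)^3 =
      (\<alpha>^3 * C^3 * \<delta>^4 + \<alpha>^2 * C * (\<gamma> * \<delta>^2 * (1 + \<alpha>) + C * (1 + \<alpha>^2 * \<gamma>)) * Z^5
          + (1 + \<alpha>^2 * \<gamma>) * Z^9) * poly ?A Z
        + (Z^3 + \<alpha> * C * Z + \<alpha> * C * \<delta>)^3 * poly ?B Z"
    unfolding poly_pCons poly_0 C_def \<delta>_def G_def by (rule eq_mod_2I) algebra
qed

lemma third_moment_certificate_special:
  fixes A \<nu> :: 'a
  shows "\<exists>P Q. degree P \<le> 8 \<and> degree Q \<le> 8 \<and>
    coeff Q 0 = A * \<nu>^9 + A^3 * \<nu>^6 + A^3 * \<nu>^8 + A^4 * \<nu>^7 + A^7 * \<nu>^2 + A^8 * \<nu> \<and>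
    (\<forall>X. \<nu>^2 * X^3 * (\<nu>^2 * X^3 + \<nu>^2 * A * X^2 + A^3)^3 =
      (\<nu>^2 * A + \<nu>^2 * X^5 + X^9) * poly P X + (X^3 + \<nu> * X + \<nu>)^3 * poly Q X)"
proof (intro exI conjI allI)
  let ?P = "[:\<nu>^10 + A^2 * \<nu>^7 + A^2 * \<nu>^9 + A^3 * \<nu>^8 + A^6 * \<nu>^3 + A^7 * \<nu>^2,
        \<nu>^10 + A * \<nu>^9 + A^2 * \<nu>^7 + A^2 * \<nu>^8 + A^2 * \<nu>^9 + A^6 * \<nu>^3,
        \<nu>^9 + \<nu>^10 + A * \<nu>^8 + A * \<nu>^9 + A^2 * \<nu>^7 + A^2 * \<nu>^9 + A^6 * \<nu>^3,
        \<nu>^8 + \<nu>^10 + A * \<nu>^9 + A^2 * \<nu>^6 + A^2 * \<nu>^7 + A^2 * \<nu>^8 + A^2 * \<nu>^9 + A^6 * \<nu>^2 + A^6 * \<nu>^3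
          + A^8,
        \<nu>^9 + A * \<nu>^8 + A * \<nu>^9 + A^3 * \<nu>^6 + A^3 * \<nu>^8 + A^7 * \<nu>^2,
        \<nu>^8 + A^2 * \<nu>^6,
        \<nu>^8 + A * \<nu>^6 + A^2 * \<nu>^5 + A^2 * \<nu>^7 + A^6 * \<nu>,
        \<nu>^8 + A * \<nu>^7 + A^2 * \<nu>^5 + A^2 * \<nu>^7 + A^4 * \<nu>^4 + A^6 * \<nu>,
        \<nu>^7 + A * \<nu>^7 + A^3 * \<nu>^6 + A^7:]"
  let ?Q = "[:A * \<nu>^9 + A^3 * \<nu>^6 + A^3 * \<nu>^8 + A^4 * \<nu>^7 + A^7 * \<nu>^2 + A^8 * \<nu>,
        A^2 * \<nu>^8 + A^3 * \<nu>^7 + A^4 * \<nu>^7 + A^8 * \<nu>,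
        A * \<nu>^8 + A^2 * \<nu>^7 + A^3 * \<nu>^7,
        A * \<nu>^7 + A^2 * \<nu>^7 + A^4 * \<nu>^6 + A^8,
        A * \<nu>^7 + A^3 * \<nu>^6 + A^4 * \<nu>^5,
        \<nu>^9 + A^2 * \<nu>^8 + A^3 * \<nu>^7 + A^4 * \<nu>^5 + A^6 * \<nu>^2 + A^7 * \<nu>,
        A * \<nu>^6 + A * \<nu>^8 + A^2 * \<nu>^5 + A^2 * \<nu>^7 + A^3 * \<nu>^7 + A^6 * \<nu> + A^7 * \<nu>,
        \<nu>^8 + A * \<nu>^7 + A^2 * \<nu>^5 + A^2 * \<nu>^7 + A^4 * \<nu>^4 + A^6 * \<nu>,
        \<nu>^7 + A * \<nu>^7 + A^3 * \<nu>^6 + A^7:]"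
  show "degree ?P \<le> 8" "degree ?Q \<le> 8" unfolding eval_nat_numeral by (intro degree_pCons_leI, simp)+
  show "coeff ?Q 0 = A * \<nu>^9 + A^3 * \<nu>^6 + A^3 * \<nu>^8 + A^4 * \<nu>^7 + A^7 * \<nu>^2 + A^8 * \<nu>" by simp
  fix X :: 'a
  show "\<nu>^2 * X^3 * (\<nu>^2 * X^3 + \<nu>^2 * A * X^2 + A^3)^3 =
      (\<nu>^2 * A + \<nu>^2 * X^5 + X^9) * poly ?P X + (X^3 + \<nu> * X + \<nu>)^3 * poly ?Q X"
    unfolding poly_pCons poly_0 by (rule eq_mod_2I) algebra
qed

lemma fifth_moment_certificate:
  fixes A :: 'a
  shows "\<exists>P Q. degree P \<le> 14 \<and> degree Q \<le> 16 \<and> coeff Q 0 = A^2 + A^3 + A^5 + A^14 \<and>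
    (\<forall>X. X^5 * (X^3 + A * X^2 + A^3)^5 = (A + X^17) * poly P X + (X^3 + X + 1)^5 * poly Q X)"
proof (intro exI conjI allI)
  let ?P = "[:A + A^2 + A^4 + A^13, A^2 + A^12 + A^13, A + A^2 + A^4 + A^12, 1 + A^4,
        A + A^2 + A^4 + A^13, A^12 + A^13 + A^14, A^2 + A^4 + A^5 + A^12, A^12, 0, A^2, A^13,
        A^4 + A^12, A + A^2 + A^4 + A^13, A^2 + A^6 + A^12 + A^13,
        A + A^2 + A^4 + A^5 + A^12 + A^13:]"
  let ?Q = "[:A^2 + A^3 + A^5 + A^14, A^2 + A^5 + A^13, A^3, A + A^2 + A^14, A + A^5 + A^13 + A^14,
        A + A^5 + A^13 + A^14, A^5 + A^6 + A^13, A^5 + A^6 + A^14, A + A^6 + A^12 + A^13,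
        A + A^5 + A^12, A + A^2 + A^12, A + A^2 + A^6, A^2 + A^5 + A^6, A + A^5 + A^6 + A^12,
        A^5 + A^12, A^2 + A^6 + A^12 + A^13, A + A^2 + A^4 + A^5 + A^12 + A^13:]"
  show "degree ?P \<le> 14" "degree ?Q \<le> 16" unfolding eval_nat_numeral by (intro degree_pCons_leI, simp)+
  show "coeff ?Q 0 = A^2 + A^3 + A^5 + A^14" by simp
  fix X :: 'a
  show "X^5 * (X^3 + A * X^2 + A^3)^5 =
      (A + X^17) * poly ?P X + (X^3 + X + 1)^5 * poly ?Q X"
    unfolding poly_pCons poly_0 by (rule eq_mod_2I) algebra
qed

end

section \<open>Necessity of \<open>a = b\<close>\<close>

context trinomial
begin

text \<open>Running the recursion backwards from k = n gives the fourth powers that enter the sparse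
  factor for e = 4.\<close>

lemma frob_two_steps_back:
  assumes "n \<ge> 2"
  shows "mi (n - 2) ^ 4 = b\<^sup>2 * (mi n + alpha * b * lam n)"
    and "lam (n - 2) ^ 4 = b * lam n + alpha\<^sup>2 * mi (n - 2) ^ 4"
proof -
  obtain k where n: "n = Suc (Suc k)" using assms by (metis add_2_eq_Suc le_Suc_ex)
  have l: "lam n = beta * (lam k ^ 4 + alpha\<^sup>2 * mi k ^ 4)"
    unfolding n frob.simps fst_conv snd_conv by (rule eq_mod_2I) algebra
  have m: "mi n = beta\<^sup>2 * mi k ^ 4 + alpha * (lam k ^ 4 + alpha\<^sup>2 * mi k ^ 4)"
    unfolding n frob.simps fst_conv snd_conv by (rule eq_mod_2I) algebra
  have bl: "b * lam n = lam k ^ 4 + alpha\<^sup>2 * mi k ^ 4"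
    unfolding l using b_beta by (simp flip: mult.assoc)
  then show "lam (n - 2) ^ 4 = b * lam n + alpha\<^sup>2 * mi (n - 2) ^ 4"
    by (simp add: n add.assoc)
  have "mi n + alpha * b * lam n = beta\<^sup>2 * mi k ^ 4"
    unfolding m mult.assoc bl by (simp add: add.assoc)
  then have "b\<^sup>2 * (mi n + alpha * b * lam n) = (b * beta)\<^sup>2 * mi k ^ 4"
    by (simp add: power_mult_distrib)
  then show "mi (n - 2) ^ 4 = b\<^sup>2 * (mi n + alpha * b * lam n)"
    by (simp add: n b_beta)
qed

lemma numerator_poly: "poly [:0, bc, 0, a, 1:] x = x * R x"
  by (simp add: R_def algebra_simps eval_nat_numeral)

text \<open>The form in which certificates are applied: they are written in the scaled variable t x,
  where fewer parameters occur, and u, U, v collect the resulting factors.\<close>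

lemma moment_vanishes:
  fixes A B :: "'a poly" and t u U v :: 'a
  assumes nz: "\<forall>x\<in>mu. h x \<noteq> 0" and inj: "inj_on g mu"
    and r: "r \<le> n" and e: "e = 2 ^ r" and s: "s \<le> e" "0 < s" "s \<le> q"
    and id: "\<And>x. u * (x * R x) ^ s =
      U * (1 + lam (n - r) ^ e * x ^ (e + 1) + mi (n - r) ^ e * x ^ (2 * e + 1)) * poly A (t * x)
        + (v * h x) ^ s * poly B (t * x)"
    and A: "degree A < 3 * s" and B: "degree B \<le> q" and v: "v \<noteq> 0"
  shows "coeff B 0 = 0"
proof -
  let ?c = "\<lambda>p. pcompose p [:0, t:]"
  have comp: "poly (?c p) x = poly p (t * x)" for p x by (simp add: poly_pcompose mult.commute)
  have deg: "degree (?c p) \<le> degree p" for p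
    by (rule order_trans[OF degree_pcompose_le]) simp
  have "(\<Sum>x\<in>mu. poly (smult u ([:0, bc, 0, a, 1:] ^ s)) x / h x ^ s)
      = coeff (smult (v ^ s) (?c B)) 0"
  proof (rule sum_certificate[OF nz r e s(1), where A = "smult U (?c A)"])
    show "degree (smult U (?c A)) < 3 * s" "degree (smult (v ^ s) (?c B)) \<le> q"
      using A B deg[of A] deg[of B] by (auto intro: le_less_trans[OF degree_smult_le] order_trans[OF degree_smult_le])
  next
    fix x
    show "poly (smult u ([:0, bc, 0, a, 1:] ^ s)) x =
      (1 + lam (n - r) ^ e * x ^ (e + 1) + mi (n - r) ^ e * x ^ (2 * e + 1)) * poly (smult U (?c A)) x
        + h x ^ s * poly (smult (v ^ s) (?c B)) x"
      unfolding poly_smult poly_power numerator_poly comp id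
      by (simp only: power_mult_distrib ac_simps)
  qed
  also have "(\<Sum>x\<in>mu. poly (smult u ([:0, bc, 0, a, 1:] ^ s)) x / h x ^ s) = u * (\<Sum>x\<in>mu. g x ^ s)"
    unfolding poly_smult poly_power numerator_poly
    by (simp add: g_def power_divide sum_distrib_left)
  also have "(\<Sum>x\<in>mu. g x ^ s) = 0" by (rule sum_g_power[OF nz inj s(2,3)])
  finally have "v ^ s * poly (?c B) 0 = 0" by (simp add: poly_0_coeff_0)
  then show ?thesis using v by (simp only: comp) (simp add: poly_0_coeff_0)
qed

section \<open>The third power sum when \<open>lam n\<close> is nonzero\<close>

lemma third_moment_generic:
  assumes nz: "\<forall>x\<in>mu. h x \<noteq> 0" and inj: "inj_on g mu" and l: "lam n \<noteq> 0"
    and n: "n \<ge> 3" and \<alpha>: "alpha \<noteq> 1"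
  defines "\<gamma> \<equiv> alpha ^ q"
  shows "1 + alpha * \<gamma> + alpha^2 * \<gamma> + alpha^2 * \<gamma>^3 + alpha^3 * \<gamma>^3 + alpha^4 * \<gamma>^2 = 0"
proof -
  define \<delta> where "\<delta> = 1 + alpha * \<gamma>"
  define G where "G = 1 + alpha * \<gamma> + alpha * \<gamma> * (alpha + \<gamma>)"
  define C where "C = alpha * \<gamma> * G"
  have m: "mi n = b" and l\<delta>: "lam n * \<delta> = \<gamma> * (1 + alpha)" and b2: "alpha * b\<^sup>2 * \<delta>\<^sup>2 = \<gamma> * G"
    using frob_of_first_moment[OF nz inj l] by (simp_all add: \<gamma>_def \<delta>_def G_def)
  have \<gamma>0: "\<gamma> \<noteq> 0" using alpha_nonzero by (simp add: \<gamma>_def)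
  have \<delta>0: "\<delta> \<noteq> 0"
  proof
    assume "\<delta> = 0"
    then have "\<gamma> * (1 + alpha) = 0" using l\<delta> by simp
    then show False using \<gamma>0 \<alpha> by (simp add: add_eq_0_iff_eq)
  qed
  have G0: "G \<noteq> 0" using b2 alpha_nonzero b_nonzero \<delta>0 by auto
  have C0: "C \<noteq> 0" using alpha_nonzero \<gamma>0 G0 by (simp add: C_def)
  \<comment> \<open>With this scale t^2 is a polynomial in alpha and \<gamma>, so that b disappears
    from the scaled \<open>R\<close>, \<open>h\<close> and sparse factor.\<close>
  define t where "t = alpha * b * \<delta>"
  have "t\<^sup>2 = alpha * (alpha * b\<^sup>2 * \<delta>\<^sup>2)" unfolding t_def by algebra
  then have t2: "t\<^sup>2 = C" unfolding b2 C_def by (simp only: mult.assoc)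
  define \<kappa> \<eta> where "\<kappa> = lam (n - 2) ^ 4" and "\<eta> = mi (n - 2) ^ 4"
  have \<eta>: "\<eta> = b ^ 3 * (1 + alpha * lam n)"
    using frob_two_steps_back(1) n m by (simp add: \<eta>_def algebra_simps eval_nat_numeral)
  have \<kappa>: "\<kappa> = b * lam n + alpha\<^sup>2 * \<eta>"
    using frob_two_steps_back(2) n by (simp add: \<kappa>_def \<eta>_def)
  have "\<eta> * \<delta> = b ^ 3 * (\<delta> + alpha * (lam n * \<delta>))"
    unfolding \<eta> by (simp add: algebra_simps)
  also have "\<delta> + alpha * (lam n * \<delta>) = 1 + alpha\<^sup>2 * \<gamma>"
    unfolding l\<delta> unfolding \<delta>_def by (rule eq_mod_2I) algebra
  finally have \<eta>\<delta>: "\<eta> * \<delta> = b ^ 3 * (1 + alpha\<^sup>2 * \<gamma>)" .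
  have \<kappa>\<delta>: "\<kappa> * \<delta> ^ 3 = b * (\<gamma> * \<delta>\<^sup>2 * (1 + alpha) + C * (1 + alpha\<^sup>2 * \<gamma>))"
  proof -
    have "\<kappa> * \<delta> ^ 3 = b * \<delta>\<^sup>2 * (lam n * \<delta>) + alpha\<^sup>2 * \<delta>\<^sup>2 * (\<eta> * \<delta>)"
      unfolding \<kappa> by algebra
    also have "\<dots> = b * (\<gamma> * \<delta>\<^sup>2 * (1 + alpha) + t\<^sup>2 * (1 + alpha\<^sup>2 * \<gamma>))"
      unfolding l\<delta> \<eta>\<delta> t_def by algebra
    finally show ?thesis by (simp add: t2)
  qed
  have t4: "t ^ 4 = C\<^sup>2" unfolding t2[symmetric] by (simp flip: power_mult)
  have c5: "alpha\<^sup>2 * C * (\<gamma> * \<delta>\<^sup>2 * (1 + alpha) + C * (1 + alpha\<^sup>2 * \<gamma>)) * t ^ 5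
      = alpha ^ 3 * C ^ 3 * \<delta> ^ 4 * \<kappa>"
  proof -
    have "t ^ 5 = C\<^sup>2 * t" using t4 by (simp add: eval_nat_numeral)
    then have "alpha\<^sup>2 * C * (\<gamma> * \<delta>\<^sup>2 * (1 + alpha) + C * (1 + alpha\<^sup>2 * \<gamma>)) * t ^ 5
        = alpha ^ 3 * C ^ 3 * \<delta> * (b * (\<gamma> * \<delta>\<^sup>2 * (1 + alpha) + C * (1 + alpha\<^sup>2 * \<gamma>)))"
      unfolding t_def by algebra
    also have "\<dots> = alpha ^ 3 * C ^ 3 * \<delta> ^ 4 * \<kappa>" unfolding \<kappa>\<delta>[symmetric] by algebra
    finally show ?thesis .
  qed
  have c9: "(1 + alpha\<^sup>2 * \<gamma>) * t ^ 9 = alpha ^ 3 * C ^ 3 * \<delta> ^ 4 * \<eta>"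
  proof -
    have "t ^ 9 = (t\<^sup>2) ^ 3 * t ^ 3" by (simp flip: power_mult power_add)
    then have "(1 + alpha\<^sup>2 * \<gamma>) * t ^ 9 = C ^ 3 * alpha ^ 3 * \<delta> ^ 3 * (b ^ 3 * (1 + alpha\<^sup>2 * \<gamma>))"
      unfolding t2 unfolding t_def by algebra
    also have "\<dots> = alpha ^ 3 * C ^ 3 * \<delta> ^ 4 * \<eta>" unfolding \<eta>\<delta>[symmetric] by algebra
    finally show ?thesis .
  qed
  have at: "a * \<delta> = t" by (simp add: t_def a_eq[symmetric])
  have bc: "\<gamma> * bc = a"
    using b_nonzero by (simp add: \<gamma>_def alpha_def power_divide a_power_q)
  have R: "\<delta> * (t * x) ^ 3 + C * (t * x)\<^sup>2 + alpha * C * G = \<delta> * t ^ 3 * R x" for x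
  proof -
    have "\<gamma> * (\<delta> * t ^ 3 * bc) = \<delta> * t ^ 3 * a" using bc by (simp flip: bc)
    also have "\<dots> = t ^ 4" unfolding at[symmetric] by algebra
    also have "\<dots> = \<gamma> * (alpha * C * G)" unfolding t4 unfolding C_def by algebra
    finally have c: "\<delta> * t ^ 3 * bc = alpha * C * G" using \<gamma>0 by simp
    have "C * (t * x)\<^sup>2 = \<delta> * t ^ 3 * (a * x\<^sup>2)"
      unfolding t2[symmetric] unfolding at[symmetric] by algebra
    then show ?thesis
      using c by (simp add: R_def distrib_left power_mult_distrib mult.assoc)
  qed
  have H: "(t * x) ^ 3 + alpha * C * (t * x) + alpha * C * \<delta> = alpha * C * \<delta> * h x" for x
  proof -
    have "(t * x) ^ 3 = alpha * C * \<delta> * (b * x ^ 3)"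
      unfolding t2[symmetric] unfolding t_def by algebra
    moreover have "alpha * C * (t * x) = alpha * C * \<delta> * (a * x)"
      unfolding at[symmetric] by algebra
    ultimately show ?thesis by (simp add: h_def distrib_left add_ac)
  qed
  obtain A B where AB: "degree A \<le> 8" "degree B \<le> 8"
    "coeff B 0 = alpha^4 * \<gamma>^2 * \<delta>^5 * G^3 *
      (1 + alpha * \<gamma> + alpha^2 * \<gamma> + alpha^2 * \<gamma>^3 + alpha^3 * \<gamma>^3 + alpha^4 * \<gamma>^2)"
    and id: "\<And>Z. alpha^2 * \<delta>^4 * G * \<gamma> * Z^3 * (\<delta> * Z^3 + C * Z^2 + alpha * C * G)^3 =
      (alpha^3 * C^3 * \<delta>^4 + alpha^2 * C * (\<gamma> * \<delta>^2 * (1 + alpha) + C * (1 + alpha^2 * \<gamma>)) * Z^5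
          + (1 + alpha^2 * \<gamma>) * Z^9) * poly A Z
        + (Z^3 + alpha * C * Z + alpha * C * \<delta>)^3 * poly B Z"
    using third_moment_certificate_generic[of alpha \<gamma>] unfolding C_def \<delta>_def G_def by blast
  \<comment> \<open>The second polynomial has degree up to 8, which must not exceed q; this is where
    n at least 3 enters.\<close>
  have "2 ^ 3 \<le> q" unfolding q_eq using n by (rule power_increasing) simp
  then have q: "8 \<le> q" by simp
  have "coeff B 0 = 0"
  proof (rule moment_vanishes[OF nz inj, where r = 2 and e = 4 and s = 3 and A = A and t = t
        and u = "alpha^2 * \<delta>^4 * G * \<gamma> * t^3 * (\<delta> * t^3)^3"
        and U = "alpha^3 * C^3 * \<delta>^4" and v = "alpha * C * \<delta>"])
    fix x
    have D: "alpha^3 * C^3 * \<delta>^4 + alpha^2 * C * (\<gamma> * \<delta>^2 * (1 + alpha) + C * (1 + alpha^2 * \<gamma>)) * (t * x)^5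
        + (1 + alpha^2 * \<gamma>) * (t * x)^9
      = alpha^3 * C^3 * \<delta>^4 * (1 + lam (n - 2) ^ 4 * x ^ (4 + 1) + mi (n - 2) ^ 4 * x ^ (2 * 4 + 1))"
      using c5 c9 by (simp add: power_mult_distrib distrib_left \<kappa>_def \<eta>_def flip: mult.assoc)
    show "alpha^2 * \<delta>^4 * G * \<gamma> * t^3 * (\<delta> * t^3)^3 * (x * R x) ^ 3 =
      alpha^3 * C^3 * \<delta>^4 * (1 + lam (n - 2) ^ 4 * x ^ (4 + 1) + mi (n - 2) ^ 4 * x ^ (2 * 4 + 1)) * poly A (t * x)
        + (alpha * C * \<delta> * h x) ^ 3 * poly B (t * x)"
      using id[of "t * x"] unfolding R H D by (simp only: power_mult_distrib ac_simps)
  qed (use AB n q alpha_nonzero C0 \<delta>0 in auto)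
  then show ?thesis using AB(3) alpha_nonzero \<gamma>0 \<delta>0 G0 by simp
qed

lemma eq_of_lam_nonzero:
  assumes nz: "\<forall>x\<in>mu. h x \<noteq> 0" and inj: "inj_on g mu" and l: "lam n \<noteq> 0"
  shows "a = b"
proof (rule ccontr)
  assume "a \<noteq> b"
  then have \<alpha>1: "alpha \<noteq> 1" by (simp add: alpha_def)
  \<comment> \<open>The case n = 2 and the last case both end by contradicting this value of
    \<open>h\<close> at 1.\<close>
  have h1: "1 + a + b \<noteq> 0" using nz[THEN bspec, of 1] by (simp add: mem_mu_iff h_def)
  have cube: "x\<^sup>2 + x + 1 = 0" if "x ^ 3 = 1" "x \<noteq> 1" for x :: 'a
  proof -
    have "(x + 1) * (x\<^sup>2 + x + 1) = x ^ 3 + 1" by (rule eq_mod_2I) algebra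
    then show ?thesis using that by (simp add: add_eq_0_iff_eq)
  qed
  have m: "mi n = b" by (rule frob_of_first_moment(1)[OF nz inj l])
  consider "n = 1" | "n = 2" | "n \<ge> 3" using n_pos by linarith
  then show False
  proof cases
    case 1
    then show False using l by simp
  next
    case 2
    then have "alpha = b" using m by (simp add: numeral_2_eq_2)
    then have ab: "a = b\<^sup>2" using a_eq by (simp add: power2_eq_square)
    have "a ^ 4 = a" using a_power_q 2 by (simp add: q_eq)
    then have "a ^ 3 = 1" using a_nonzero by (simp add: eval_nat_numeral)
    then have "(b ^ 3) ^ 2 ^ 1 = 1 ^ 2 ^ 1" by (simp add: ab flip: power_mult)
    then have "b ^ 3 = 1" by (simp only: power_2pow_inj)
    moreover have "b \<noteq> 1" using \<open>a \<noteq> b\<close> ab by auto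
    ultimately have "b\<^sup>2 + b + 1 = 0" by (rule cube)
    then show False using h1 unfolding ab by (simp only: add_ac) simp
  next
    case 3
    define \<gamma> where "\<gamma> = alpha ^ q"
    have \<gamma>0: "\<gamma> \<noteq> 0" using alpha_nonzero by (simp add: \<gamma>_def)
    let ?Z = "\<lambda>x y :: 'a. 1 + x * y + x^2 * y + x^2 * y^3 + x^3 * y^3 + x^4 * y^2"
    have Z: "?Z alpha \<gamma> = 0"
      using third_moment_generic[OF nz inj l 3 \<alpha>1] by (simp add: \<gamma>_def)
    have pw: "(x ^ k) ^ q = (x ^ q) ^ k" for x :: 'a and k by (simp add: mult.commute flip: power_mult)
    have "\<gamma> ^ q = alpha" by (simp add: \<gamma>_def power_q_q)
    then have "?Z \<gamma> alpha = (?Z alpha \<gamma>) ^ q"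
      by (simp add: power_q_add power_mult_distrib pw \<gamma>_def[symmetric])
    then have Z': "?Z \<gamma> alpha = 0" using Z q_ge_2 by (simp add: zero_power)
    have b2: "alpha * b\<^sup>2 * (1 + alpha * \<gamma>)\<^sup>2 = \<gamma> * (1 + alpha * \<gamma> + alpha * \<gamma> * (alpha + \<gamma>))"
      using frob_of_first_moment(3)[OF nz inj l] by (simp add: \<gamma>_def)
    have "lam n * (1 + alpha * \<gamma>) = \<gamma> * (1 + alpha)"
      using frob_of_first_moment(2)[OF nz inj l] by (simp add: \<gamma>_def)
    then have "1 + alpha * \<gamma> \<noteq> 0" using \<gamma>0 \<alpha>1 by (auto simp: add_eq_0_iff_eq)
    then have G0: "1 + alpha * \<gamma> + alpha * \<gamma> * (alpha + \<gamma>) \<noteq> 0"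
      using b2 alpha_nonzero b_nonzero by auto
    \<comment> \<open>The relation and its conjugate have a sum that factors; every factor except
      alpha + \<gamma> is nonzero, so alpha is self-conjugate.\<close>
    have "alpha * \<gamma> * (alpha + \<gamma>) * (1 + alpha * \<gamma> + alpha * \<gamma> * (alpha + \<gamma>)) = ?Z alpha \<gamma> + ?Z \<gamma> alpha"
      by (rule eq_mod_2I) algebra
    then have eq: "\<gamma> = alpha"
      using Z Z' G0 alpha_nonzero \<gamma>0 by (simp add: add_eq_0_iff_eq)
    have "(1 + alpha)\<^sup>2 * (1 + alpha ^ 3) = ?Z alpha alpha" by (rule eq_mod_2I) algebra
    then have "alpha ^ 3 = 1" using Z \<alpha>1 unfolding eq by (simp add: add_eq_0_iff_eq)
    then have s: "alpha\<^sup>2 + alpha + 1 = 0" using cube \<alpha>1 by blast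
    \<comment> \<open>For alpha = \<gamma> a primitive cube root of unity, the formula for b^2
      reduces to b = alpha, and then h(1) is alpha^2 + alpha + 1 = 0.\<close>
    have "(alpha\<^sup>2 * (b + alpha))\<^sup>2 = 0"
    proof -
      have "(alpha\<^sup>2 * (b + alpha))\<^sup>2 = alpha * (alpha * b\<^sup>2 * (1 + alpha * alpha)\<^sup>2
            + alpha * (1 + alpha * alpha + alpha * alpha * (alpha + alpha)))
          + (alpha\<^sup>2 + alpha + 1) * (alpha\<^sup>2 * b\<^sup>2 * (alpha\<^sup>2 + alpha + 1) + (alpha ^ 4 + alpha ^ 3 + alpha\<^sup>2))"
        by (rule eq_mod_2I) algebra
      then show ?thesis using b2 s unfolding eq by simp
    qed
    then have "b = alpha" using alpha_nonzero by (simp add: add_eq_0_iff_eq)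
    then have "a = alpha\<^sup>2" "b = alpha" using a_eq by (simp_all add: power2_eq_square)
    then show False using h1 s by (simp only: add_ac)
  qed
qed

section \<open>The case \<open>lam n = 0\<close>\<close>

context
  assumes l: "lam n = 0"
begin

text \<open>This is a^3 / b; it proves to be the inverse of \<open>dd\<close> and a cube root of
  unity.\<close>

definition nu :: 'a where "nu = alpha * a\<^sup>2"

lemma mi_eq_a: "mi n = a" and dd_nu: "dd * nu = 1"
proof -
  let ?m = "mi n"
  have r3: "dd * ?m\<^sup>2 * (beta * ?m) = 1" using rel_nu l by (simp add: ac_simps)
  then have m0: "?m \<noteq> 0" by auto
  have "(alpha * ?m\<^sup>2) * (dd * ?m\<^sup>2 * alpha) = (alpha * ?m\<^sup>2) * 1"
    using rel_theta l by (simp add: power2_eq_square ac_simps)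
  then have r1: "dd * ?m\<^sup>2 * alpha = 1" using m0 alpha_nonzero by simp
  then have "beta * ?m = alpha" using r3 by (metis mult_left_cancel mult_zero_left zero_neq_one)
  then have "b * beta * ?m = alpha * b" by (simp add: mult.assoc mult.commute)
  then show m: "?m = a" using b_beta a_eq by simp
  show "dd * nu = 1" using r1 unfolding m nu_def by (simp only: ac_simps)
qed

lemma nu_nonzero: "nu \<noteq> 0"
  using dd_nu by auto

lemma nu_power_q: "nu ^ q = nu\<^sup>2"
proof -
  have "alpha ^ q = alpha * nu"
    using alpha_conj dd_nu by (metis mult.assoc mult.right_neutral)
  then have "nu ^ q = alpha * nu * (a ^ q)\<^sup>2"
    by (simp add: nu_def power_mult_distrib mult.commute flip: power_mult)
  then show ?thesis by (simp add: a_power_q nu_def power2_eq_square ac_simps)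
qed

text \<open>The conjugate of \<open>nu\<close> is both \<open>nu\<^sup>2\<close> and
  \<open>dd\<close>, the inverse of \<open>nu\<close>, because \<open>dd\<close> has norm 1.\<close>

lemma nu_cube: "nu ^ 3 = 1"
proof -
  have c1: "dd ^ q * nu ^ q = 1" by (simp only: dd_nu power_one flip: power_mult_distrib)
  have c2: "dd * dd ^ q = 1"
    using b_nonzero by (simp add: beta_def power_mult_distrib power_q_q power_inverse field_simps)
  have "nu ^ q = (dd * dd ^ q) * nu ^ q" by (simp only: c2 mult_1)
  also have "\<dots> = dd" by (simp only: mult.assoc c1 mult_1_right)
  finally have "nu ^ q = dd" .
  then show ?thesis using nu_power_q dd_nu by (simp add: power3_eq_cube power2_eq_square mult.commute)
qed

lemma nu_mem_mu: "nu \<in> mu"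
  using nu_cube nu_power_q by (simp add: mem_mu_iff power3_eq_cube power2_eq_square mult.assoc)

lemma nu_b: "nu * b = a ^ 3"
  using a_eq by (simp add: nu_def power3_eq_cube power2_eq_square ac_simps)

lemma nu_bc: "nu * bc = b"
proof -
  have "nu * bc = (b * beta) * (nu * bc)" by (simp only: b_beta mult_1)
  also have "\<dots> = b * (dd * nu)" by (simp only: ac_simps)
  finally have "nu * bc = b * (dd * nu)" .
  then show ?thesis by (simp add: dd_nu)
qed

lemma two_steps_back_special:
  assumes "n \<ge> 2"
  shows "lam (n - 2) ^ 4 = a ^ 3" and "nu\<^sup>2 * mi (n - 2) ^ 4 = a ^ 7"
proof -
  have \<eta>: "mi (n - 2) ^ 4 = b\<^sup>2 * a"
    using frob_two_steps_back(1)[OF assms] l mi_eq_a by simp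
  have "lam (n - 2) ^ 4 = alpha\<^sup>2 * (b\<^sup>2 * a)"
    using frob_two_steps_back(2)[OF assms] l \<eta> by simp
  also have "\<dots> = (alpha * b)\<^sup>2 * a" by (simp add: power_mult_distrib)
  also have "\<dots> = a ^ 3" unfolding a_eq[symmetric] by (simp add: power2_eq_square power3_eq_cube)
  finally show "lam (n - 2) ^ 4 = a ^ 3" .
  have "nu\<^sup>2 * mi (n - 2) ^ 4 = (nu * b)\<^sup>2 * a" unfolding \<eta> by algebra
  also have "\<dots> = a ^ 7" unfolding nu_b by algebra
  finally show "nu\<^sup>2 * mi (n - 2) ^ 4 = a ^ 7" .
qed

text \<open>In the variable a x only \<open>nu\<close> and a^2 remain as parameters.\<close>

lemma scaled_R: "nu\<^sup>2 * (a * x) ^ 3 + nu\<^sup>2 * a\<^sup>2 * (a * x)\<^sup>2 + (a\<^sup>2) ^ 3 = nu\<^sup>2 * a ^ 3 * R x"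
proof -
  have c: "nu\<^sup>2 * bc = a ^ 3"
    using nu_b nu_bc by (simp add: power2_eq_square mult.assoc)
  have "nu\<^sup>2 * a ^ 3 * (x ^ 3 + a * x\<^sup>2 + c)
      = nu\<^sup>2 * (a * x) ^ 3 + nu\<^sup>2 * a\<^sup>2 * (a * x)\<^sup>2 + a ^ 3 * (nu\<^sup>2 * c)" for c
    by algebra
  then have "nu\<^sup>2 * a ^ 3 * R x
      = nu\<^sup>2 * (a * x) ^ 3 + nu\<^sup>2 * a\<^sup>2 * (a * x)\<^sup>2 + a ^ 3 * a ^ 3"
    unfolding R_def c[symmetric] .
  then show ?thesis by (simp flip: power_mult power_add)
qed

lemma scaled_h: "(a * x) ^ 3 + nu * (a * x) + nu = nu * h x"
proof -
  have "nu * h x = nu + nu * a * x + (nu * b) * x ^ 3" by (simp add: h_def algebra_simps)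
  then show ?thesis unfolding nu_b by (simp add: power_mult_distrib ac_simps)
qed

lemma third_moment_special:
  assumes nz: "\<forall>x\<in>mu. h x \<noteq> 0" and inj: "inj_on g mu" and n: "n \<ge> 3"
  defines "A \<equiv> a\<^sup>2"
  shows "1 + A^2 * (1 + nu^2) + nu * A^3 + nu^2 * A^6 + nu * A^7 = 0"
proof -
  obtain P Q where PQ: "degree P \<le> 8" "degree Q \<le> 8"
    "coeff Q 0 = A * nu^9 + A^3 * nu^6 + A^3 * nu^8 + A^4 * nu^7 + A^7 * nu^2 + A^8 * nu"
    and id: "\<And>X. nu^2 * X^3 * (nu^2 * X^3 + nu^2 * A * X^2 + A^3)^3 =
      (nu^2 * A + nu^2 * X^5 + X^9) * poly P X + (X^3 + nu * X + nu)^3 * poly Q X"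
    using third_moment_certificate_special[of A nu] by blast
  have "2 ^ 3 \<le> q" unfolding q_eq using n by (rule power_increasing) simp
  then have q: "8 \<le> q" by simp
  have "coeff Q 0 = 0"
  proof (rule moment_vanishes[OF nz inj, where r = 2 and e = 4 and s = 3 and A = P and t = a
        and u = "nu^2 * a^3 * (nu^2 * a^3)^3" and U = "nu^2 * A" and v = nu])
    fix x
    have D: "nu^2 * A + nu^2 * (a * x)^5 + (a * x)^9
      = nu^2 * A * (1 + lam (n - 2) ^ 4 * x ^ (4 + 1) + mi (n - 2) ^ 4 * x ^ (2 * 4 + 1))"
    proof -
      have "nu^2 * A * (1 + lam (n - 2) ^ 4 * x ^ 5 + mi (n - 2) ^ 4 * x ^ 9)
        = nu^2 * A + nu^2 * A * lam (n - 2) ^ 4 * x ^ 5 + A * (nu^2 * mi (n - 2) ^ 4) * x ^ 9"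
        by algebra
      also have "\<dots> = nu^2 * A + nu^2 * (a * x)^5 + (a * x)^9"
        using two_steps_back_special n unfolding A_def
        by (simp add: power_mult_distrib mult.assoc flip: power_add)
      finally show ?thesis by simp
    qed
    show "nu^2 * a^3 * (nu^2 * a^3)^3 * (x * R x) ^ 3 =
      nu^2 * A * (1 + lam (n - 2) ^ 4 * x ^ (4 + 1) + mi (n - 2) ^ 4 * x ^ (2 * 4 + 1)) * poly P (a * x)
        + (nu * h x) ^ 3 * poly Q (a * x)"
      using id[of "a * x"] unfolding A_def scaled_R scaled_h D[unfolded A_def]
      by (simp only: power_mult_distrib ac_simps)
  qed (use PQ n q nu_nonzero in auto)
  \<comment> \<open>Cubes of \<open>nu\<close> are split off so that each becomes 1, and the nonzero
    factor A is removed.\<close>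
  moreover have "coeff Q 0 = A * (1 + A^2 * (1 + nu^2) + nu * A^3 + nu^2 * A^6 + nu * A^7)"
  proof -
    have "coeff Q 0 = A * ((nu^3)^3 + A^2 * ((nu^3)^2 + (nu^3)^2 * nu^2) + (nu^3)^2 * nu * A^3
        + nu^2 * A^6 + nu * A^7)"
      unfolding PQ(3) by algebra
    then show ?thesis unfolding nu_cube by simp
  qed
  ultimately show ?thesis using a_nonzero by (simp add: A_def)
qed

text \<open>For \<open>nu\<close> = 1 this is a second condition on A, to be combined with the third
  power sum. Exponent 5 uses e = 8, and the degree bound 16 requires n at least 4.\<close>

lemma fifth_moment_special:
  assumes nz: "\<forall>x\<in>mu. h x \<noteq> 0" and inj: "inj_on g mu" and n: "n \<ge> 4" and nu: "nu = 1"
  defines "A \<equiv> a\<^sup>2"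
  shows "1 + A + A^3 + A^12 = 0"
proof -
  obtain P Q where PQ: "degree P \<le> 14" "degree Q \<le> 16"
    "coeff Q 0 = A^2 + A^3 + A^5 + A^14"
    and id: "\<And>X. X^5 * (X^3 + A * X^2 + A^3)^5 = (A + X^17) * poly P X + (X^3 + X + 1)^5 * poly Q X"
    using fifth_moment_certificate[of A] by blast
  have "2 ^ 4 \<le> q" unfolding q_eq using n by (rule power_increasing) simp
  then have q: "16 \<le> q" by simp
  define k where "k = n - 3"
  have k: "n = Suc (Suc (Suc k))" using n by (simp add: k_def)
  have b: "b = a ^ 3" using nu_b nu by simp
  have "beta ^ 4 * mi k ^ 8 = lam (n - 2) ^ 4" by (simp add: k power_mult_distrib flip: power_mult)
  also have "\<dots> = a ^ 3" using two_steps_back_special(1) n by simp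
  finally have "(b * beta) ^ 4 * mi k ^ 8 = b ^ 4 * a ^ 3" by (simp add: power_mult_distrib)
  then have mk: "mi k ^ 8 = a ^ 15" unfolding b_beta by (simp add: b flip: power_mult power_add)
  have "lam k ^ 8 + alpha ^ 4 * mi k ^ 8 = mi (n - 2) ^ 4"
  proof -
    have "mi (n - 2) ^ 4 = ((lam k)\<^sup>2 + alpha * (mi k)\<^sup>2) ^ 2 ^ 2" by (simp add: k)
    also have "\<dots> = lam k ^ 8 + alpha ^ 4 * mi k ^ 8"
      unfolding power_2pow_add by (simp add: power_mult_distrib flip: power_mult)
    finally show ?thesis by simp
  qed
  also have "\<dots> = a ^ 7" using two_steps_back_special(2) n nu by simp
  also have "\<dots> = alpha ^ 4 * mi k ^ 8"
  proof -
    have "alpha * a\<^sup>2 = 1" using nu by (simp add: nu_def)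
    then have "(alpha * a\<^sup>2) ^ 4 * a ^ 7 = a ^ 7" by simp
    then show ?thesis unfolding mk by (simp add: power_mult_distrib mult.assoc flip: power_mult power_add)
  qed
  \<comment> \<open>Three steps back the first coordinate vanishes, so the sparse factor loses its
    middle term and becomes A + X^17.\<close>
  finally have lk: "lam k = 0" by simp
  have nk: "n - 3 = k" by (simp add: k_def)
  have "coeff Q 0 = 0"
  proof (rule moment_vanishes[OF nz inj, where r = 3 and e = 8 and s = 5 and A = P and t = a
        and u = "a^5 * (a^3)^5" and U = A and v = 1])
    fix x
    have D: "A + (a * x)^17
      = A * (1 + lam (n - 3) ^ 8 * x ^ (8 + 1) + mi (n - 3) ^ 8 * x ^ (2 * 8 + 1))"
      unfolding nk lk mk A_def by (simp add: power_mult_distrib distrib_left flip: mult.assoc power_add)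
    have R: "(a * x)^3 + A * (a * x)^2 + A^3 = a^3 * R x"
      using scaled_R[of x] by (simp add: nu A_def)
    have H: "(a * x)^3 + a * x + 1 = 1 * h x"
      using scaled_h[of x] by (simp add: nu)
    show "a^5 * (a^3)^5 * (x * R x) ^ 5 =
      A * (1 + lam (n - 3) ^ 8 * x ^ (8 + 1) + mi (n - 3) ^ 8 * x ^ (2 * 8 + 1)) * poly P (a * x)
        + (1 * h x) ^ 5 * poly Q (a * x)"
      using id[of "a * x"] unfolding R H D by (simp only: power_mult_distrib ac_simps)
  qed (use PQ n q in auto)
  moreover have "coeff Q 0 = A\<^sup>2 * (1 + A + A^3 + A^12)" unfolding PQ(3) by algebra
  ultimately show ?thesis using a_nonzero by (simp add: A_def)
qed

lemma eq_of_lam_zero: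
  assumes nz: "\<forall>x\<in>mu. h x \<noteq> 0" and inj: "inj_on g mu"
  shows "a = b"
proof -
  have s: "nu\<^sup>2 + (nu + 1) = 0" if "nu \<noteq> 1"
  proof -
    have "(nu + 1) * (nu\<^sup>2 + (nu + 1)) = nu ^ 3 + 1" by (rule eq_mod_2I) algebra
    then show ?thesis using that nu_cube by (simp add: add_eq_0_iff_eq)
  qed
  define A where "A = a\<^sup>2"
  have "A = 1"
  proof (cases "n = 1")
    case True
    then show ?thesis using mi_eq_a by (simp add: A_def)
  next
    case False
    \<comment> \<open>\<open>lam 2\<close> is \<open>beta\<close> and \<open>lam 3\<close> is
      \<open>beta * alpha\<^sup>2\<close>, both nonzero.\<close>
    have "n \<noteq> 2" "n \<noteq> 3"
      using l alpha_nonzero beta_nonzero by (auto simp: numeral_2_eq_2 numeral_3_eq_3)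
    then have n: "n \<ge> 4" using False n_pos by linarith
    have E3: "1 + A^2 * (1 + nu^2) + nu * A^3 + nu^2 * A^6 + nu * A^7 = 0"
      using third_moment_special[OF nz inj] n by (simp add: A_def)
    show ?thesis
    proof (cases "nu = 1")
      case True
      have e3: "1 + A^3 + A^6 + A^7 = 0" using E3 True by simp
      have e5: "1 + A + A^3 + A^12 = 0"
        using fifth_moment_special[OF nz inj n True] by (simp add: A_def)
      \<comment> \<open>A Bezout combination of the two moment conditions.\<close>
      have "(A + 1)\<^sup>2 = (1 + A + A^4 + A^7 + A^8) * (1 + A^3 + A^6 + A^7)
          + (A + A^3) * (1 + A + A^3 + A^12)"
        by (rule eq_mod_2I) algebra
      then show ?thesis using e3 e5 by (simp add: add_eq_0_iff_eq)
    next
      case False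
      define S where "S = A^2 + A^3 + A^7"
      \<comment> \<open>Using 1 + nu^2 = nu, the condition becomes quadratic in \<open>nu\<close>
        with coefficients in \<open>K\<close>.\<close>
      have e: "1 + nu * S + nu^2 * A^6 = 0"
      proof -
        have "1 + nu * S + nu^2 * A^6 = (1 + A^2 * (1 + nu^2) + nu * A^3 + nu^2 * A^6 + nu * A^7)
            + A^2 * (nu^2 + (nu + 1))"
          unfolding S_def by (rule eq_mod_2I) algebra
        then show ?thesis unfolding E3 s[OF False] by simp
      qed
      have "A ^ q = A" by (simp add: A_def a_power_q mult.commute flip: power_mult)
        (simp add: power_mult a_power_q)
      then have Aq: "(A ^ k) ^ q = A ^ k" for k by (metis mult.commute power_mult)
      have n2: "(nu^2) ^ q = (nu^2)^2" by (metis nu_power_q mult.commute power_mult)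
      \<comment> \<open>Conjugation fixes A and exchanges the two primitive cube roots of unity,
        giving a second equation for S and A^6.\<close>
      have "1 + nu^2 * S + (nu^2)^2 * A^6 = (1 + nu * S + nu^2 * A^6) ^ q"
        unfolding S_def power_q_add power_mult_distrib Aq nu_power_q n2 by simp
      also have "\<dots> = 0" unfolding e using q_ge_2 by (simp add: zero_power)
      finally have e': "1 + nu^2 * S + (nu^2)^2 * A^6 = 0" .
      have "S + A^6 = (1 + nu * S + nu^2 * A^6) + (1 + nu^2 * S + (nu^2)^2 * A^6)
          + (nu^2 + (nu + 1)) * S + (nu ^ 3 + 1) * nu * A ^ 6 + (nu^2 + (nu + 1)) * A ^ 6"
        by (rule eq_mod_2I) algebra
      then have SA: "S = A ^ 6"
        unfolding e e' s[OF False] nu_cube by (simp add: add_eq_0_iff_eq)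
      have "1 + A ^ 6 = (1 + nu * S + nu^2 * A^6) + nu * (S + A ^ 6) + (nu^2 + (nu + 1)) * A^6"
        by (rule eq_mod_2I) algebra
      then have A6: "A ^ 6 = 1" unfolding e s[OF False] using SA by (simp add: add_eq_0_iff_eq)
      then have "(A ^ 3) ^ 2 ^ 1 = 1 ^ 2 ^ 1" by (simp flip: power_mult)
      then have A3: "A ^ 3 = 1" by (simp only: power_2pow_inj)
      have "A * (A + 1) = (S + A ^ 6) + (A ^ 3 + 1) * (A ^ 4 + A + 1) + (A ^ 6 + 1)"
        unfolding S_def by (rule eq_mod_2I) algebra
      then show ?thesis using SA A3 A6 a_nonzero by (simp add: A_def add_eq_0_iff_eq)
    qed
  qed
  then have "a ^ 2 ^ 1 = 1 ^ 2 ^ 1" by (simp add: A_def)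
  then have a1: "a = 1" by (simp only: power_2pow_inj)
  define w where "w = nu"
  note w = nu_cube[folded w_def] nu_b[folded w_def] nu_mem_mu[folded w_def] s[folded w_def]
  have "b = w ^ 3 * b" using w(1) by simp
  also have "\<dots> = w\<^sup>2 * (w * b)" by algebra
  finally have b: "b = w\<^sup>2" using w(2) a1 by simp
  show ?thesis
  proof (cases "w = 1")
    case True
    then show ?thesis using a1 b by simp
  next
    case False
    \<comment> \<open>With a = 1 and b = w^2, a primitive cube root w in \<open>mu\<close> would be
      a zero of \<open>h\<close>.\<close>
    have "h w = 1 + a * w + b * w ^ 3" by (rule h_def)
    also have "\<dots> = w\<^sup>2 + (w + 1)" unfolding w(1) a1 unfolding b by (simp add: ac_simps)
    also have "\<dots> = 0" by (rule w(4)[OF False])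
    finally show ?thesis using bspec[OF nz w(3)] by contradiction
  qed
qed

end

lemma eq_of_permutes:
  assumes "\<forall>x\<in>mu. h x \<noteq> 0" "inj_on g mu"
  shows "a = b"
proof (cases "lam n = 0")
  case True
  then show ?thesis using assms by (rule eq_of_lam_zero)
next
  case False
  with assms show ?thesis by (rule eq_of_lam_nonzero)
qed

end

section \<open>The permutation criterion assembled from the cases \<open>a = b\<close> and
  \<open>a \<noteq> b\<close>\<close>

theorem theorem1p1:
  fixes q n :: nat and K :: "'a::{field,finite} set" and a b :: 'a and f :: "'a poly"
  assumes "n \<ge> 1" and "q = 2 ^ n"
    and "CARD('a) = q\<^sup>2"
    and "is_subfield K" and "card K = q"
    and "a \<in> K" and "a \<noteq> 0"
    and "b \<noteq> 0"
    and "f = monom 1 4 * (1 + monom a (q - 1) + monom b (3 * (q - 1)))"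
  shows "permutation_poly f \<longleftrightarrow>
    a = b \<and> \<not> (\<exists>x\<in>K. poly (monom 1 3 + monom 1 1 + [:inverse a:]) x = 0)"
proof -
  interpret trinomial q n K a b
    using assms by unfold_locales
  have root: "poly (monom 1 3 + monom 1 1 + [:inverse a:]) x = x ^ 3 + x + inverse a" for x
    by (simp add: poly_monom)
  show ?thesis
  proof (cases "a = b")
    case True
    then have "permutation_poly f \<longleftrightarrow> inj_on g mu"
      using permutation_poly_iff[OF assms(9)] h_nonzero_of_eq[OF True] by simp
    then show ?thesis unfolding inj_on_g_iff[OF True] root using True by simp
  next
    case False
    then have "\<not> ((\<forall>x\<in>mu. h x \<noteq> 0) \<and> inj_on g mu)" using eq_of_permutes by metis
    then show ?thesis using permutation_poly_iff[OF assms(9)] False by simp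
  qed
qed

end
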